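(* Let $I=(-1,1)$ and let $\psi\in C(\bar I)$ be a symmetric cone, i.e. $\psi(x)=\psi(-x)$ for all $x$ and $\psi$ is affine on $(0,1)$, such that $\psi(\pm1)<0$ and $h:=\psi(0)>0$. Let $$X_\psi=\{u\in W^{2,2}(I): u(\pm1)=0,\ u\ge\psi \text{ on } I\},\qquad X_{\psi,\mathrm{sym}}=\{u\in X_\psi: u(x)=u(-x)\},$$ and $B[u]=\int_I u''(x)^2(1+u'(x)^2)^{-5/2}\,dx$ (the total squared curvature of the graph of $u$). Let $c_*=\int_0^{\pi/2}\sqrt{\cos\varphi}\,d\varphi$ and $h_*=2/c_*$. If $h<h_*$, then there exists a unique $\bar u\in X_{\psi,\mathrm{sym}}$ with $B[\bar u]=\inf_{X_{\psi,\mathrm{sym}}}B$. If $h\ge h_*$, then there is no minimizer of $B$ in $X_{\psi,\mathrm{sym}}$, and there is no minimizer of $B$ in $X_\psi$.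
   Context: A minimizer of $B$ in a class $Y$ means an element $u\in Y$ with $B[u]=\inf_{v\in Y}B[v]$. Numerically $h_*\approx1.66925$. *)

theory Defs
  imports "HOL-Analysis.Analysis"
begin

abbreviation I_int :: "real set" where "I_int \<equiv> {-1<..<1}"

definition test_fun :: "(real \<Rightarrow> real) \<Rightarrow> bool" where
  "test_fun \<phi> \<longleftrightarrow> (\<forall>n x. ((deriv ^^ n) \<phi>) differentiable (at x)) \<and>
     (\<exists>a b. -1 < a \<and> b < 1 \<and> (\<forall>x. x \<notin> {a..b} \<longrightarrow> \<phi> x = 0))"

text \<open>Membership in L^2(I) (on a bounded interval, this includes L^1).\<close>
definition L2_I :: "(real \<Rightarrow> real) \<Rightarrow> bool" where
  "L2_I f \<longleftrightarrow> f absolutely_integrable_on I_int \<and> (\<lambda>x. (f x)\<^sup>2) integrable_on I_int"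

definition weak_deriv :: "(real \<Rightarrow> real) \<Rightarrow> (real \<Rightarrow> real) \<Rightarrow> bool" where
  "weak_deriv u v \<longleftrightarrow> (\<forall>\<phi>. test_fun \<phi> \<longrightarrow>
      integral I_int (\<lambda>x. u x * deriv \<phi> x) = - integral I_int (\<lambda>x. v x * \<phi> x))"

text \<open>u is (the continuous representative on the closed interval of) an element of W^{2,2}(I).\<close>
definition W22 :: "(real \<Rightarrow> real) \<Rightarrow> bool" where
  "W22 u \<longleftrightarrow> continuous_on {-1..1} u \<and> L2_I u \<and>
     (\<exists>v w. L2_I v \<and> L2_I w \<and> weak_deriv u v \<and> weak_deriv v w)"

definition Bfun :: "(real \<Rightarrow> real) \<Rightarrow> real" where
  "Bfun u = (SOME b. \<exists>v w. L2_I v \<and> L2_I w \<and> weak_deriv u v \<and> weak_deriv v w \<and>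
      b = integral I_int (\<lambda>x. (w x)\<^sup>2 * (1 + (v x)\<^sup>2) powr (-5/2)))"

definition X_psi :: "(real \<Rightarrow> real) \<Rightarrow> (real \<Rightarrow> real) set" where
  "X_psi \<psi> = {u. W22 u \<and> u (-1) = 0 \<and> u 1 = 0 \<and> (\<forall>x\<in>I_int. u x \<ge> \<psi> x)}"

definition X_psi_sym :: "(real \<Rightarrow> real) \<Rightarrow> (real \<Rightarrow> real) set" where
  "X_psi_sym \<psi> = {u \<in> X_psi \<psi>. \<forall>x\<in>{-1..1}. u x = u (-x)}"

definition is_minimizer :: "(real \<Rightarrow> real) set \<Rightarrow> (real \<Rightarrow> real) \<Rightarrow> bool" where
  "is_minimizer Y u \<longleftrightarrow> u \<in> Y \<and> Bfun u = (INF v\<in>Y. Bfun v)"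

definition c_star :: real where
  "c_star = integral {0..pi/2} (\<lambda>\<phi>. sqrt (cos \<phi>))"

definition h_star :: real where
  "h_star = 2 / c_star"

end

theory Submission
  imports Defs
begin

text \<open>
  With \<open>p = -u'\<close> and an angle \<open>\<beta>\<close> such that \<open>tan \<beta> = max p\<close>, completing the square for the curvature term
  \<open>p' (1 + p^2)^(-5/4)\<close> against \<open>\<mu> (sin \<beta> - p cos \<beta>)^(1/2)\<close> is a calibration: the cross term is an
  exact derivative and contributes \<open>2 \<mu> Y(\<beta>)\<close> with \<open>Y(\<beta>) = \<integral>\<^sub>0\<^sup>\<beta> sqrt (sin t) dt\<close>, the remaining term only
  sees the length of the interval and the height. So on an interval of length \<open>l\<close> starting at a
  critical point of \<open>u\<close> of height \<open>H\<close> the energy is at least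
  \<open>2 \<mu> Y(\<beta>) - \<mu>^2 (l sin \<beta> - H cos \<beta>)\<close>, for every \<open>\<mu>\<close>.

  If \<open>H \<ge> h_star\<close>, the choice \<open>\<mu> = c_star / sqrt (sin \<beta>)\<close> and the monotonicity of
  \<open>Y(\<beta>) / sqrt (sin \<beta>) + cot \<beta>\<close> give more than \<open>c_star^2 (2 - l)\<close>; adding both sides of a maximum point
  of \<open>u\<close> gives \<open>B[u] > 2 c_star^2\<close>, while steep rectangular elasticae continued by straight lines
  have energy arbitrarily close to \<open>2 c_star^2\<close>.

  If \<open>h < h_star\<close>, there is a rectangular elastica of height \<open>h\<close>, with end angle \<open>\<alpha>\<close> say. For its multiplier
  \<open>\<mu>\<close> the lower bound, as a function of \<open>\<beta>\<close>, has its unique minimum at \<open>\<alpha>\<close>, where it is the energy of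
  the elastica. Equality forces the first order equation
  \<open>p' (1 + p^2)^(-5/4) = \<mu> (sin \<alpha> - p cos \<alpha>)^(1/2)\<close>, whose right-hand side decreases in \<open>p\<close>,
  so that the solution is unique.
\<close>

section \<open>Test functions\<close>

text \<open>The family x^(-k) exp(-1/x), continued by 0. For \<open>k = 0\<close> it is the standard
  flat function; larger \<open>k\<close> are there because its derivatives of all orders are linear
  combinations of members of the family.\<close>

definition flat_exp :: "nat \<Rightarrow> real \<Rightarrow> real" where
  "flat_exp k x = (if x \<le> 0 then 0 else (1/x)^k * exp (-(1/x)))"

lemma flat_exp_tendsto_0: "(flat_exp k \<longlongrightarrow> 0) (at 0)"
proof (rule filterlim_split_at)
  have "\<forall>\<^sub>F x in at_left 0. flat_exp k x = 0"
    by (auto simp: flat_exp_def eventually_at_filter)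
  then show "(flat_exp k \<longlongrightarrow> 0) (at_left 0)"
    by (rule tendsto_eventually)
  have "((\<lambda>x::real. (inverse x)^k / exp (inverse x)) \<longlongrightarrow> 0) (at_right 0)"
    by (rule filterlim_compose[OF tendsto_power_div_exp_0 filterlim_inverse_at_top_right])
  moreover have "\<forall>\<^sub>F x in at_right 0. (inverse x)^k / exp (inverse x) = flat_exp k x"
    by (auto simp: flat_exp_def eventually_at_filter exp_minus field_simps)
  ultimately show "(flat_exp k \<longlongrightarrow> 0) (at_right 0)"
    by (rule Lim_transform_eventually)
qed

lemma flat_exp_has_derivative:
  "(flat_exp k has_real_derivative (flat_exp (k + 2) x - k * flat_exp (Suc k) x)) (at x)"
proof -
  consider "x < 0" | "x = 0" | "x > 0" by linarith
  then show ?thesis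
  proof cases
    case 1
    have "((\<lambda>_. 0) has_real_derivative 0) (at x)" by simp
    then have "(flat_exp k has_real_derivative 0) (at x)"
      by (rule has_field_derivative_transform_within_open[where S = "{..<0}"])
        (use 1 in \<open>auto simp: flat_exp_def\<close>)
    with 1 show ?thesis by (simp add: flat_exp_def)
  next
    case 2
    have "(flat_exp k has_real_derivative 0) (at 0)"
      unfolding has_field_derivative_iff
    \<comment> \<open>The difference quotient of \<open>flat_exp k\<close> at 0 is
      \<open>flat_exp (Suc k)\<close> itself, whose limit is already known.\<close>
    proof (rule Lim_transform_eventually[OF flat_exp_tendsto_0[of "Suc k"]])
      show "\<forall>\<^sub>F y in at 0. flat_exp (Suc k) y = (flat_exp k y - flat_exp k 0) / (y - 0)"
        by (auto simp: flat_exp_def eventually_at_filter field_simps)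
    qed
    with 2 show ?thesis by (simp add: flat_exp_def)
  next
    case 3
    have "((\<lambda>x. (1/x)^k * exp (-(1/x))) has_real_derivative
        ((1/x)^(k+2) * exp (-(1/x)) - k * ((1/x)^(Suc k) * exp (-(1/x))))) (at x)"
    proof (cases k)
      case 0
      with 3 show ?thesis
        by (auto intro!: derivative_eq_intros simp: field_simps power2_eq_square)
    next
      case (Suc j)
      have i: "((\<lambda>x. 1/x) has_real_derivative - ((1/x)^2)) (at x)"
        using 3 by (auto intro!: derivative_eq_intros simp: field_simps power2_eq_square)
      have e: "((\<lambda>x. exp (-(1/x))) has_real_derivative exp (-(1/x)) * (1/x)^2) (at x)"
        using DERIV_chain2[OF DERIV_exp DERIV_minus[OF i]] by simp
      show ?thesis
        unfolding Suc by (rule DERIV_cong[OF DERIV_mult[OF DERIV_power_Suc[OF i] e]])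
          (simp add: algebra_simps power2_eq_square)
    qed
    then have "(flat_exp k has_real_derivative
        ((1/x)^(k+2) * exp (-(1/x)) - k * ((1/x)^(Suc k) * exp (-(1/x))))) (at x)"
      by (rule has_field_derivative_transform_within_open[where S = "{0<..}"])
        (use 3 in \<open>auto simp: flat_exp_def\<close>)
    with 3 show ?thesis by (simp add: flat_exp_def)
  qed
qed

lemma flat_exp_bounds: "0 \<le> flat_exp 0 x" "flat_exp 0 x \<le> 1"
  by (auto simp: flat_exp_def)

text \<open>The point of this algebra is that it is closed under differentiation, so its members are smooth
  without any Leibniz formula for higher derivatives.\<close>

inductive flat_alg :: "(real \<Rightarrow> real) \<Rightarrow> bool" where
  const: "flat_alg (\<lambda>x. c)"
| ident: "flat_alg (\<lambda>x. x)"
| flat: "flat_alg (\<lambda>x. flat_exp k (a * x + b))"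
| add: "flat_alg f \<Longrightarrow> flat_alg g \<Longrightarrow> flat_alg (\<lambda>x. f x + g x)"
| mult: "flat_alg f \<Longrightarrow> flat_alg g \<Longrightarrow> flat_alg (\<lambda>x. f x * g x)"

lemma flat_alg_derivative:
  "flat_alg f \<Longrightarrow> \<exists>f'. flat_alg f' \<and> (\<forall>x. (f has_real_derivative f' x) (at x))"
proof (induction rule: flat_alg.induct)
  case (const c)
  show ?case by (intro exI[of _ "\<lambda>x. 0"] conjI flat_alg.const) auto
next
  case ident
  show ?case by (intro exI[of _ "\<lambda>x. 1"] conjI flat_alg.const) auto
next
  case (flat k a b)
  let ?f' = "\<lambda>x. a * (flat_exp (k + 2) (a * x + b) + (- real k) * flat_exp (Suc k) (a * x + b))"
  have "flat_alg ?f'"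
    by (intro flat_alg.mult flat_alg.add flat_alg.const flat_alg.flat)
  moreover have "((\<lambda>x. flat_exp k (a * x + b)) has_real_derivative ?f' x) (at x)" for x
    by (rule DERIV_cong[OF DERIV_chain2[OF flat_exp_has_derivative]])
      (auto intro!: derivative_eq_intros)
  ultimately show ?case by blast
next
  case (add f g)
  then obtain f' g' where "flat_alg f'" "flat_alg g'"
    "\<And>x. (f has_real_derivative f' x) (at x)" "\<And>x. (g has_real_derivative g' x) (at x)"
    by blast
  then show ?case
    by (intro exI[of _ "\<lambda>x. f' x + g' x"] conjI flat_alg.add allI DERIV_add)
next
  case (mult f g)
  then obtain f' g' where "flat_alg f'" "flat_alg g'"
    "\<And>x. (f has_real_derivative f' x) (at x)" "\<And>x. (g has_real_derivative g' x) (at x)"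
    by blast
  with mult show ?case
    by (intro exI[of _ "\<lambda>x. f' x * g x + g' x * f x"] conjI flat_alg.add flat_alg.mult allI DERIV_mult)
qed

lemma flat_alg_continuous: "flat_alg f \<Longrightarrow> continuous_on S f"
  by (meson DERIV_continuous continuous_at_imp_continuous_on flat_alg_derivative)

lemma flat_alg_smooth: "flat_alg f \<Longrightarrow> ((deriv ^^ n) f) differentiable (at x)"
proof (induction n arbitrary: f)
  case 0
  then show ?case using flat_alg_derivative real_differentiable_def by fastforce
next
  case (Suc n)
  obtain f' where f': "flat_alg f'" "\<And>x. (f has_real_derivative f' x) (at x)"
    using flat_alg_derivative[OF Suc.prems] by blast
  then have "deriv f = f'"
    by (intro ext DERIV_imp_deriv)
  with Suc.IH[OF f'(1)] show ?case
    by (simp add: funpow_Suc_right del: funpow.simps)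
qed

text \<open>Puts the polynomials supplied by the Stone-Weierstrass theorem into the algebra, so that
  after multiplication with a cutoff they become test functions.\<close>

lemma flat_alg_polynomial: "real_polynomial_function f \<Longrightarrow> flat_alg f"
proof (induction rule: real_polynomial_function.induct)
  case (linear f)
  then have "f x = f 1 * x" for x
    using linear_scale[OF bounded_linear.linear[OF linear], of x 1] by (simp add: mult.commute)
  then have "f = (\<lambda>x. f 1 * x)" by (rule ext)
  moreover have "flat_alg (\<lambda>x. f 1 * x)"
    by (intro flat_alg.mult flat_alg.const flat_alg.ident)
  ultimately show ?case by metis
qed (auto intro: flat_alg.intros)

section \<open>Smooth cutoffs of the interval\<close>

text \<open>There is no plateau of value 1. The limit 1 at each interior point, together with the
  bound 1, is what dominated convergence asks for.\<close>

definition cutoff :: "nat \<Rightarrow> real \<Rightarrow> real" where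
  "cutoff n x = flat_exp 0 (real n * x + (real n - 1)) * flat_exp 0 ((- real n) * x + (real n - 1))"

lemma flat_alg_cutoff: "flat_alg (cutoff n)"
  unfolding cutoff_def by (intro flat_alg.mult flat_alg.flat)

lemma cutoff_bounds: "\<bar>cutoff n x\<bar> \<le> 1"
  using flat_exp_bounds by (simp add: cutoff_def abs_mult mult_le_one)

lemma cutoff_eq_0:
  assumes "n > 0" "x \<notin> {-1 + 1/(real n) .. 1 - 1/(real n)}"
  shows "cutoff n x = 0"
proof -
  consider "x < -1 + 1/n" | "x > 1 - 1/n" using assms by fastforce
  then show ?thesis
  proof cases
    case 1
    then have "real n * x \<le> real n * (-1 + 1/n)" by (intro mult_left_mono) auto
    also have "\<dots> = 1 - real n" using assms by (simp add: field_simps)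
    finally show ?thesis by (simp add: cutoff_def flat_exp_def)
  next
    case 2
    then have "real n * x \<ge> real n * (1 - 1/n)" by (intro mult_left_mono) auto
    also have "real n * (1 - 1/n) = real n - 1" using assms by (simp add: field_simps)
    finally show ?thesis by (simp add: cutoff_def flat_exp_def)
  qed
qed

lemma cutoff_tendsto_1:
  assumes "x \<in> {-1<..<1}"
  shows "(\<lambda>n. cutoff n x) \<longlonglongrightarrow> 1"
proof -
  have *: "(\<lambda>n. flat_exp 0 (real n * y - 1)) \<longlonglongrightarrow> 1" if "y > 0" for y
  proof -
    have "filterlim (\<lambda>n. y * real n) at_top sequentially"
      using that by (rule filterlim_tendsto_pos_mult_at_top[OF tendsto_const _ filterlim_real_sequentially])
    from filterlim_tendsto_add_at_top[OF tendsto_const[of "-1"] this]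
    have lim: "filterlim (\<lambda>n. real n * y - 1) at_top sequentially"
      by (simp add: algebra_simps)
    have "(\<lambda>n. exp (- (1 / (real n * y - 1)))) \<longlonglongrightarrow> exp (- 0)"
      using lim by (intro tendsto_intros tendsto_divide_0[OF tendsto_const] filterlim_at_top_imp_at_infinity)
    moreover have "\<forall>\<^sub>F n in sequentially. exp (- (1 / (real n * y - 1))) = flat_exp 0 (real n * y - 1)"
      using filterlim_at_top_dense[THEN iffD1, OF lim, rule_format, of 0]
      by eventually_elim (auto simp: flat_exp_def)
    ultimately show ?thesis using Lim_transform_eventually by fastforce
  qed
  have "(\<lambda>n. flat_exp 0 (real n * (x + 1) - 1) * flat_exp 0 (real n * (1 - x) - 1)) \<longlonglongrightarrow> 1 * 1"
    using assms by (intro tendsto_mult *) auto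
  then show ?thesis by (simp add: cutoff_def algebra_simps)
qed

lemma flat_alg_test_fun:
  assumes "flat_alg f" "n > 0"
  shows "test_fun (\<lambda>x. f x * cutoff n x)"
  unfolding test_fun_def
proof
  show "\<forall>k x. (deriv ^^ k) (\<lambda>x. f x * cutoff n x) differentiable at x"
    using flat_alg_smooth[OF flat_alg.mult[OF assms(1) flat_alg_cutoff]] by blast
  show "\<exists>a b. -1 < a \<and> b < 1 \<and> (\<forall>x. x \<notin> {a..b} \<longrightarrow> f x * cutoff n x = 0)"
    using cutoff_eq_0[OF assms(2)] assms(2)
    by (intro exI[of _ "-1 + 1/real n"] exI[of _ "1 - 1/real n"]) auto
qed

section \<open>Weak derivatives on an interval\<close>

lemma absolutely_integrable_continuous_mult:
  fixes f g :: "real \<Rightarrow> real"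
  assumes "f absolutely_integrable_on {a..b}" "continuous_on {a..b} g"
  shows "(\<lambda>x. g x * f x) absolutely_integrable_on {a..b}"
proof (rule absolutely_integrable_bounded_measurable_product_real)
  show "g \<in> borel_measurable (lebesgue_on {a..b})"
    by (intro continuous_imp_measurable_on_sets_lebesgue assms) auto
  show "bounded (g ` {a..b})"
    by (intro compact_imp_bounded compact_continuous_image assms) auto
qed (use assms in auto)

lemma negligible_if_integral_abs_eq_0:
  fixes f :: "real \<Rightarrow> real"
  assumes f: "f absolutely_integrable_on {a..b}" and "integral {a..b} (\<lambda>x. \<bar>f x\<bar>) = 0"
  shows "negligible {x \<in> {a..b}. f x \<noteq> 0}"
proof -
  have i: "integrable (lebesgue_on {a..b}) f"
    using f by (simp add: absolutely_integrable_imp_integrable)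
  have "(\<lambda>x. \<bar>f x\<bar>) absolutely_integrable_on {a..b}"
    using absolutely_integrable_norm[OF f] by (simp add: o_def)
  then have "(\<integral>x. \<bar>f x\<bar> \<partial>(lebesgue_on {a..b})) = 0"
    using assms(2) by (subst lebesgue_integral_eq_integral) (auto simp: absolutely_integrable_imp_integrable)
  then have "emeasure (lebesgue_on {a..b}) {x \<in> space (lebesgue_on {a..b}). f x \<noteq> 0} = 0"
    using integral_norm_eq_0_iff[OF i] by simp
  moreover have "{x \<in> space (lebesgue_on {a..b}). f x \<noteq> 0} \<in> sets (lebesgue_on {a..b})"
    using borel_measurable_integrable[OF i] by measurable
  ultimately have "{x \<in> space (lebesgue_on {a..b}). f x \<noteq> 0} \<in> null_sets (lebesgue_on {a..b})"
    by (simp add: null_setsI)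
  then show ?thesis
    by (simp add: negligible_iff_null_sets null_sets_restrict_space)
qed

text \<open>The products of \<open>g\<close> with the cutoffs are test functions; dominated
  convergence with majorant \<open>\<bar>g x * f x\<bar>\<close> removes the cutoff.\<close>

lemma fundamental_lemma_flat_alg:
  assumes f: "f absolutely_integrable_on {-1..1}"
    and zero: "\<And>\<phi>. flat_alg \<phi> \<Longrightarrow> test_fun \<phi> \<Longrightarrow> integral {-1..1} (\<lambda>x. f x * \<phi> x) = 0"
    and g: "flat_alg g"
  shows "integral {-1..1} (\<lambda>x. f x * g x) = 0"
proof -
  have gf: "(\<lambda>x. g x * f x) absolutely_integrable_on {-1..1}"
    by (rule absolutely_integrable_continuous_mult[OF f flat_alg_continuous[OF g]])
  let ?F = "\<lambda>n x. f x * (g x * cutoff (Suc n) x)"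
  have "(\<lambda>n. integral {-1<..<1} (?F n)) \<longlonglongrightarrow> integral {-1<..<1} (\<lambda>x. f x * g x)"
  proof (rule dominated_convergence)
    fix n
    have "(\<lambda>x. (g x * cutoff (Suc n) x) * f x) absolutely_integrable_on {-1..1}"
      by (intro absolutely_integrable_continuous_mult f flat_alg_continuous flat_alg.mult g flat_alg_cutoff)
    then show "?F n integrable_on {-1<..<1}"
      unfolding integrable_on_open_interval_real
      by (simp add: mult.commute[of "f _"] set_lebesgue_integral_eq_integral)
  next
    show "(\<lambda>x. \<bar>g x * f x\<bar>) integrable_on {-1<..<1}"
      unfolding integrable_on_open_interval_real
      using gf by (simp add: absolutely_integrable_on_def)
  next
    fix n x show "norm (?F n x) \<le> \<bar>g x * f x\<bar>"
      using mult_left_mono[OF cutoff_bounds[of "Suc n" x], of "\<bar>g x * f x\<bar>"]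
      by (simp add: abs_mult mult_ac)
  next
    fix x :: real assume x: "x \<in> {-1<..<1}"
    have "(\<lambda>n. ?F n x) \<longlonglongrightarrow> f x * (g x * 1)"
      by (intro tendsto_intros LIMSEQ_Suc cutoff_tendsto_1 x)
    then show "(\<lambda>n. ?F n x) \<longlonglongrightarrow> f x * g x" by simp
  qed
  moreover have "integral {-1<..<1} (?F n) = 0" for n
    using zero[OF flat_alg.mult[OF g flat_alg_cutoff] flat_alg_test_fun[OF g], of "Suc n"] by (simp add: integral_open_interval_real)
  ultimately show ?thesis
    by (simp add: integral_open_interval_real LIMSEQ_const_iff)
qed

text \<open>A uniform polynomial approximation of \<open>g\<close> with error \<open>e\<close>
  changes the integral by at most \<open>e\<close> times the integral of
  \<open>\<bar>f x\<bar>\<close>, and for polynomials the integral is 0.\<close>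

lemma fundamental_lemma_continuous:
  assumes f: "f absolutely_integrable_on {-1..1}"
    and zero: "\<And>\<phi>. flat_alg \<phi> \<Longrightarrow> test_fun \<phi> \<Longrightarrow> integral {-1..1} (\<lambda>x. f x * \<phi> x) = 0"
    and g: "continuous_on {-1..1} g"
  shows "integral {-1..1} (\<lambda>x. g x * f x) = 0"
proof (rule ccontr)
  let ?J = "integral {-1..1} (\<lambda>x. g x * f x)" and ?N = "integral {-1..1} (\<lambda>x. \<bar>f x\<bar>)"
  assume "?J \<noteq> 0"
  have af: "(\<lambda>x. \<bar>f x\<bar>) integrable_on {-1..1}"
    using f by (simp add: absolutely_integrable_on_def)
  have N: "?N \<ge> 0" by (intro integral_nonneg af) auto
  \<comment> \<open>Chosen so that \<open>e * ?N < \<bar>?J\<bar>\<close>; the added 1 covers the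
    case \<open>?N = 0\<close>.\<close>
  define e where "e = \<bar>?J\<bar> / (?N + 1)"
  have "e > 0" using \<open>?J \<noteq> 0\<close> N by (simp add: e_def)
  from Stone_Weierstrass_real_polynomial_function[OF compact_Icc g this]
  obtain r where r: "real_polynomial_function r" "\<And>x. x \<in> {-1..1} \<Longrightarrow> \<bar>g x - r x\<bar> < e"
    by blast
  have ri: "(\<lambda>x. r x * f x) integrable_on {-1..1}" and gi: "(\<lambda>x. g x * f x) integrable_on {-1..1}"
    using absolutely_integrable_continuous_mult[OF f] g flat_alg_continuous[OF flat_alg_polynomial[OF r(1)]]
    by (simp_all add: set_lebesgue_integral_eq_integral)
  have "integral {-1..1} (\<lambda>x. r x * f x) = 0"
    using fundamental_lemma_flat_alg[OF f zero flat_alg_polynomial[OF r(1)]] by (simp add: mult.commute)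
  then have "?J = integral {-1..1} (\<lambda>x. g x * f x - r x * f x)"
    by (simp add: integral_diff[OF gi ri])
  also have "\<bar>\<dots>\<bar> \<le> integral {-1..1} (\<lambda>x. e * \<bar>f x\<bar>)"
  proof -
    have "norm (integral {-1..1} (\<lambda>x. g x * f x - r x * f x)) \<le> integral {-1..1} (\<lambda>x. e * \<bar>f x\<bar>)"
    proof (rule integral_norm_bound_integral)
      fix x :: real assume "x \<in> {-1..1}"
      then show "norm (g x * f x - r x * f x) \<le> e * \<bar>f x\<bar>"
        using mult_right_mono[OF less_imp_le[OF r(2)], of x "\<bar>f x\<bar>"]
        by (simp add: abs_mult[symmetric] left_diff_distrib)
    qed (use ri gi af in \<open>auto intro!: integrable_diff integrable_on_mult_right\<close>)
    then show ?thesis by simp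
  qed
  also have "\<dots> = e * ?N" by simp
  also have "\<dots> < \<bar>?J\<bar>"
    using \<open>?J \<noteq> 0\<close> N by (simp add: e_def field_simps)
  finally show False by simp
qed

text \<open>Testing with the sign of \<open>f\<close> would give the integral of
  \<open>\<bar>f x\<bar>\<close>. The sign is measurable, hence an almost everywhere limit of
  continuous functions, for which the integral is 0.\<close>

lemma fundamental_lemma:
  assumes f: "f absolutely_integrable_on {-1..1}"
    and zero: "\<And>\<phi>. flat_alg \<phi> \<Longrightarrow> test_fun \<phi> \<Longrightarrow> integral {-1..1} (\<lambda>x. f x * \<phi> x) = 0"
  shows "negligible {x \<in> {-1..1}. f x \<noteq> 0}"
proof (rule negligible_if_integral_abs_eq_0[OF f])
  have "f \<in> borel_measurable (lebesgue_on {-1..1})"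
    using borel_measurable_integrable[OF absolutely_integrable_imp_integrable[OF f]] by simp
  then have "(\<lambda>x. sgn (f x)) \<in> borel_measurable (lebesgue_on {-1..1})"
    by measurable
  then have "(\<lambda>x. sgn (f x)) measurable_on {-1..1}"
    by (simp add: measurable_on_iff_borel_measurable)
  then obtain N g where N: "negligible N" and g: "\<And>n. continuous_on UNIV (g n)"
    and lim: "\<And>x. x \<notin> N \<Longrightarrow> (\<lambda>n. g n x) \<longlonglongrightarrow> (if x \<in> {-1..1} then sgn (f x) else 0)"
    unfolding measurable_on_def by blast
  \<comment> \<open>Truncation to [-1,1] does not disturb the limit, which is a sign, and makes
    \<open>\<bar>f' x\<bar>\<close> a majorant.\<close>
  define k where "k n x = max (-1) (min 1 (g n x)) " for n :: nat and x :: real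
  have kc: "continuous_on {-1..1} (k n)" for n
    unfolding k_def by (intro continuous_intros continuous_on_subset[OF g]) auto
  \<comment> \<open>Setting \<open>f\<close> to 0 on the exceptional null set turns almost
    everywhere convergence into convergence at every point.\<close>
  define f' where "f' x = (if x \<in> N then 0 else f x)" for x
  have f': "f' absolutely_integrable_on {-1..1}"
    by (rule absolutely_integrable_spike[OF f N]) (auto simp: f'_def)
  have kf: "(\<lambda>x. k n x * f x) absolutely_integrable_on {-1..1}"
       "(\<lambda>x. k n x * f' x) absolutely_integrable_on {-1..1}" for n
    using absolutely_integrable_continuous_mult f f' kc by blast+
  have "(\<lambda>n. integral {-1..1} (\<lambda>x. k n x * f' x)) \<longlonglongrightarrow> integral {-1..1} (\<lambda>x. \<bar>f' x\<bar>)"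
  proof (rule dominated_convergence)
    show "(\<lambda>x. k n x * f' x) integrable_on {-1..1}" for n
      using kf by (simp add: set_lebesgue_integral_eq_integral)
    show "(\<lambda>x. \<bar>f' x\<bar>) integrable_on {-1..1}"
      using f' by (simp add: absolutely_integrable_on_def)
    show "norm (k n x * f' x) \<le> \<bar>f' x\<bar>" for n x
    proof -
      have "\<bar>k n x\<bar> \<le> 1" by (auto simp: k_def)
      from mult_right_mono[OF this, of "\<bar>f' x\<bar>"] show ?thesis by (simp add: abs_mult)
    qed
    show "(\<lambda>n. k n x * f' x) \<longlonglongrightarrow> \<bar>f' x\<bar>" if "x \<in> {-1..1}" for x
    proof (cases "x \<in> N")
      case True then show ?thesis by (simp add: f'_def)
    next
      case False
      with lim that have "(\<lambda>n. g n x) \<longlonglongrightarrow> sgn (f x)" by fastforce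
      then have "(\<lambda>n. k n x) \<longlonglongrightarrow> max (-1) (min 1 (sgn (f x)))"
        unfolding k_def by (intro tendsto_intros)
      also have "max (-1) (min 1 (sgn (f x))) = sgn (f x)" by (auto simp: sgn_if)
      finally have "(\<lambda>n. k n x * f' x) \<longlonglongrightarrow> sgn (f x) * f' x" by (intro tendsto_intros)
      with False show ?thesis by (simp add: f'_def abs_sgn mult.commute)
    qed
  qed
  moreover have "integral {-1..1} (\<lambda>x. k n x * f' x) = 0" for n
  proof -
    have "integral {-1..1} (\<lambda>x. k n x * f' x) = integral {-1..1} (\<lambda>x. k n x * f x)"
      by (rule integral_spike[OF N]) (auto simp: f'_def)
    also have "\<dots> = 0" by (rule fundamental_lemma_continuous[OF f zero kc])
    finally show ?thesis .
  qed
  ultimately have "integral {-1..1} (\<lambda>x. \<bar>f' x\<bar>) = 0"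
    by (simp add: LIMSEQ_const_iff)
  moreover have "integral {-1..1} (\<lambda>x. \<bar>f' x\<bar>) = integral {-1..1} (\<lambda>x. \<bar>f x\<bar>)"
    by (rule integral_spike[OF N]) (auto simp: f'_def)
  ultimately show "integral {-1..1} (\<lambda>x. \<bar>f x\<bar>) = 0" by simp
qed

section \<open>The chain rule for absolutely continuous functions\<close>

text \<open>By the mean value theorem the increment of \<open>Q\<close> along \<open>p\<close> is
  \<open>Q' (p t)\<close> times the increment of \<open>p\<close>, for some \<open>t\<close> in the
  interval. Replacing \<open>Q' (p t)\<close> by \<open>Q' (p s)\<close> under the integral costs at
  most the oscillation \<open>e\<close>.\<close>

lemma integral_chain_rule_local:
  fixes q :: "real \<Rightarrow> real"
  assumes q: "q absolutely_integrable_on {a..b}" and ab: "a \<le> x" "x \<le> y" "y \<le> b"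
    and p: "\<And>x. x \<in> {a..b} \<Longrightarrow> p x = p a + integral {a..x} q"
    and Q: "\<And>s. (Q has_real_derivative Q' s) (at s)" and pc: "continuous_on {a..b} p"
    and Q'p: "continuous_on {a..b} (\<lambda>x. Q' (p x))"
    and close: "\<And>s t. s \<in> {x..y} \<Longrightarrow> t \<in> {x..y} \<Longrightarrow> \<bar>Q' (p s) - Q' (p t)\<bar> \<le> e"
  shows "\<bar>Q (p y) - Q (p x) - integral {x..y} (\<lambda>t. Q' (p t) * q t)\<bar> \<le> e * integral {x..y} (\<lambda>t. \<bar>q t\<bar>)"
proof -
  have sub: "{x..y} \<subseteq> {a..b}" using ab by auto
  have qxy: "q absolutely_integrable_on {x..y}"
    using absolutely_integrable_on_subinterval[OF q sub] .
  have qi: "q integrable_on {x..y}" and aqi: "(\<lambda>t. \<bar>q t\<bar>) integrable_on {x..y}"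
    using qxy by (simp_all add: absolutely_integrable_on_def)
  have Qi: "(\<lambda>t. Q' (p t) * q t) integrable_on {x..y}"
    using absolutely_integrable_continuous_mult[OF qxy continuous_on_subset[OF Q'p sub]]
    by (simp add: set_lebesgue_integral_eq_integral)
  have pxy: "p y - p x = integral {x..y} q"
  proof -
    have "integral {a..x} q + integral {x..y} q = integral {a..y} q"
      by (rule Henstock_Kurzweil_Integration.integral_combine)
        (use ab in \<open>auto intro!: absolutely_integrable_on_subinterval[OF q, THEN set_lebesgue_integral_eq_integral(1)]\<close>)
    then show ?thesis using p[of x] p[of y] ab by simp
  qed
  obtain t where t: "t \<in> {x..y}" and Qt: "Q (p y) - Q (p x) = Q' (p t) * (p y - p x)"
  proof -
    have "\<exists>s\<in>closed_segment (p x) (p y). Q (p y) - Q (p x) = Q' s * (p y - p x)"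
    proof (cases "p x" "p y" rule: linorder_cases)
      case less
      from MVT2[OF less, of Q Q'] Q obtain z where "p x < z" "z < p y"
         "Q (p y) - Q (p x) = (p y - p x) * Q' z" by blast
      with less show ?thesis by (intro bexI[of _ z]) (auto simp: closed_segment_eq_real_ivl)
    next
      case equal then show ?thesis by auto
    next
      case greater
      from MVT2[OF greater, of Q Q'] Q obtain z where "p y < z" "z < p x"
         "Q (p x) - Q (p y) = (p x - p y) * Q' z" by blast
      with greater show ?thesis
        by (intro bexI[of _ z]) (auto simp: closed_segment_eq_real_ivl algebra_simps)
    qed
    then obtain s where s: "s \<in> closed_segment (p x) (p y)" "Q (p y) - Q (p x) = Q' s * (p y - p x)"
      by blast
    \<comment> \<open>The mean value point lies between \<open>p x\<close> and \<open>p y\<close>;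
      it is a value of \<open>p\<close> on \<open>{x..y}\<close> because a connected set of reals is
      convex.\<close>
    have "connected (p ` {x..y})"
      by (intro connected_continuous_image continuous_on_subset[OF pc sub]) auto
    then have "convex (p ` {x..y})"
      using is_interval_connected_1 is_interval_convex_1 by blast
    with ab have "closed_segment (p x) (p y) \<subseteq> p ` {x..y}"
      by (intro closed_segment_subset) auto
    with s that show ?thesis by blast
  qed
  have "Q (p y) - Q (p x) - integral {x..y} (\<lambda>t. Q' (p t) * q t)
      = integral {x..y} (\<lambda>s. Q' (p t) * q s - Q' (p s) * q s)"
    unfolding Qt pxy using Qi qi by (subst integral_diff) (auto intro: integrable_on_mult_right)
  also have "norm \<dots> \<le> integral {x..y} (\<lambda>s. e * \<bar>q s\<bar>)"
  proof (rule integral_norm_bound_integral)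
    fix s assume "s \<in> {x..y}"
    from mult_right_mono[OF close[OF t this], of "\<bar>q s\<bar>"]
    show "norm (Q' (p t) * q s - Q' (p s) * q s) \<le> e * \<bar>q s\<bar>"
      by (simp add: abs_mult[symmetric] left_diff_distrib)
  qed (use Qi qi aqi in \<open>auto intro!: integrable_diff integrable_on_mult_right\<close>)
  finally show ?thesis by simp
qed

text \<open>The composition of \<open>Q'\<close> with \<open>p\<close> is uniformly continuous, so
  on a fine enough uniform partition the local estimate holds with any prescribed \<open>e\<close>.
  Summed up, the total error is at most \<open>e\<close> times the integral of
  \<open>\<bar>q t\<bar>\<close>, hence 0.\<close>

lemma absolutely_continuous_chain_rule:
  fixes q :: "real \<Rightarrow> real"
  assumes q: "q absolutely_integrable_on {a..b}" and ab: "a \<le> b"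
    and p: "\<And>x. x \<in> {a..b} \<Longrightarrow> p x = p a + integral {a..x} q"
    and Q: "\<And>s. (Q has_real_derivative Q' s) (at s)" and Q': "continuous_on UNIV Q'"
  shows "((\<lambda>x. Q' (p x) * q x) has_integral Q (p b) - Q (p a)) {a..b}"
proof -
  have qi: "q integrable_on {a..b}" and aqi: "(\<lambda>t. \<bar>q t\<bar>) integrable_on {a..b}"
    using q by (simp_all add: absolutely_integrable_on_def)
  have "continuous_on {a..b} (\<lambda>x. p a + integral {a..x} q)"
    by (intro continuous_intros indefinite_integral_continuous_1 qi)
  then have pc: "continuous_on {a..b} p"
    by (rule continuous_on_eq) (rule p[symmetric])
  have Q'p: "continuous_on {a..b} (\<lambda>x. Q' (p x))"
    by (rule continuous_on_compose2[OF Q' pc]) auto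
  have Qi: "(\<lambda>t. Q' (p t) * q t) integrable_on {a..b}"
    using absolutely_integrable_continuous_mult[OF q Q'p] by (simp add: set_lebesgue_integral_eq_integral)
  let ?J = "integral {a..b} (\<lambda>t. Q' (p t) * q t)" and ?N = "integral {a..b} (\<lambda>t. \<bar>q t\<bar>)"
  have N0: "?N \<ge> 0" by (intro integral_nonneg aqi) auto
  have small: "\<bar>Q (p b) - Q (p a) - ?J\<bar> \<le> e * ?N" if "e > 0" for e
  proof -
    have "uniformly_continuous_on {a..b} (\<lambda>x. Q' (p x))"
      by (rule compact_uniformly_continuous[OF Q'p]) auto
    then obtain d where d: "d > 0"
      "\<And>s t. s \<in> {a..b} \<Longrightarrow> t \<in> {a..b} \<Longrightarrow> \<bar>s - t\<bar> < d \<Longrightarrow> \<bar>Q' (p s) - Q' (p t)\<bar> < e"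
      unfolding uniformly_continuous_on_def dist_real_def using \<open>e > 0\<close> by (meson abs_minus_commute)
    obtain n0 where n0: "real n0 > (b - a) / d"
      using reals_Archimedean2 by blast
    define n where "n = Suc n0"
    have n: "real n > (b - a) / d" "n > 0"
      using n0 by (simp_all add: n_def)
    define z where "z k = a + real k * ((b - a) / real n)" for k
    have h: "(b - a) / real n < d" "(b - a) / real n \<ge> 0"
      using n d ab by (auto simp: field_simps)
    \<comment> \<open>Induction along the partition points \<open>z k\<close>: the local errors add
      up because both integrals are additive.\<close>
    have "z k \<in> {a..b} \<and> \<bar>Q (p (z k)) - Q (p a) - integral {a..z k} (\<lambda>t. Q' (p t) * q t)\<bar>
        \<le> e * integral {a..z k} (\<lambda>t. \<bar>q t\<bar>)" if "k \<le> n" for k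
      using that
    proof (induction k)
      case 0 then show ?case using ab by (simp add: z_def)
    next
      case (Suc k)
      have zk: "z k \<in> {a..b}" and IH: "\<bar>Q (p (z k)) - Q (p a) - integral {a..z k} (\<lambda>t. Q' (p t) * q t)\<bar>
        \<le> e * integral {a..z k} (\<lambda>t. \<bar>q t\<bar>)" using Suc by auto
      have step: "z (Suc k) = z k + (b - a) / real n" by (simp add: z_def distrib_right add_divide_distrib)
      have "real (Suc k) * ((b - a) / real n) \<le> real n * ((b - a) / real n)"
        using Suc.prems h by (intro mult_right_mono) auto
      then have zs: "z (Suc k) \<le> b" using n by (simp add: z_def)
      have "\<bar>Q (p (z (Suc k))) - Q (p (z k)) - integral {z k..z (Suc k)} (\<lambda>t. Q' (p t) * q t)\<bar>
         \<le> e * integral {z k..z (Suc k)} (\<lambda>t. \<bar>q t\<bar>)"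
      proof (rule integral_chain_rule_local[OF q _ _ zs p Q pc Q'p])
        fix s t assume "s \<in> {z k..z (Suc k)}" "t \<in> {z k..z (Suc k)}"
        then show "\<bar>Q' (p s) - Q' (p t)\<bar> \<le> e"
          using zk zs step h by (intro less_imp_le d) auto
      qed (use zk step h in auto)
      moreover have split: "integral {a..z (Suc k)} f = integral {a..z k} f + integral {z k..z (Suc k)} f"
        if "f integrable_on {a..b}" for f :: "real \<Rightarrow> real"
        by (rule Henstock_Kurzweil_Integration.integral_combine[symmetric])
          (use zk zs step h in \<open>auto intro: integrable_on_subinterval[OF that]\<close>)
      ultimately have "\<bar>Q (p (z (Suc k))) - Q (p a) - integral {a..z (Suc k)} (\<lambda>t. Q' (p t) * q t)\<bar>
        \<le> e * integral {a..z (Suc k)} (\<lambda>t. \<bar>q t\<bar>)"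
        using IH unfolding split[OF Qi] split[OF aqi] distrib_left by linarith
      then show ?case using zk zs step h by auto
    qed
    from this[of n] n show ?thesis by (simp add: z_def)
  qed
  have "Q (p b) - Q (p a) = ?J"
  proof (rule ccontr)
    assume ne: "Q (p b) - Q (p a) \<noteq> ?J"
    let ?e = "\<bar>Q (p b) - Q (p a) - ?J\<bar> / (?N + 1)"
    have "?e > 0" using ne N0 by simp
    from small[OF this] have "\<bar>Q (p b) - Q (p a) - ?J\<bar> * (?N + 1) \<le> \<bar>Q (p b) - Q (p a) - ?J\<bar> * ?N"
      using N0 by (simp add: field_simps)
    with ne show False by (simp add: algebra_simps)
  qed
  with Qi show ?thesis by (simp add: has_integral_iff)
qed

lemma test_fun_facts:
  assumes "test_fun \<phi>"
  shows "(\<phi> has_real_derivative deriv \<phi> x) (at x)" "continuous_on S (deriv \<phi>)" "continuous_on S \<phi>"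
    "\<phi> (-1) = 0" "\<phi> 1 = 0"
proof -
  have d: "((deriv ^^ n) \<phi>) differentiable (at x)" for n x
    using assms by (simp add: test_fun_def)
  have d0: "(\<phi> has_real_derivative deriv \<phi> x) (at x)" for x
    using d[of 0 x] DERIV_deriv_iff_real_differentiable by auto
  then show "(\<phi> has_real_derivative deriv \<phi> x) (at x)" .
  show "continuous_on S \<phi>"
    using d0 DERIV_continuous continuous_at_imp_continuous_on by blast
  have "isCont (deriv \<phi>) x" for x
    using d[of 1 x] by (auto intro: differentiable_imp_continuous_within)
  then show "continuous_on S (deriv \<phi>)"
    by (simp add: continuous_at_imp_continuous_on)
  obtain a b where "-1 < a" "b < 1" "\<And>x. x \<notin> {a..b} \<Longrightarrow> \<phi> x = 0"
    using assms unfolding test_fun_def by blast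
  then show "\<phi> (-1) = 0" "\<phi> 1 = 0" by auto
qed

lemma abs_int_primitive_continuous:
  fixes q :: "real \<Rightarrow> real"
  assumes "q absolutely_integrable_on {a..b}"
    and "\<And>x. x \<in> {a..b} \<Longrightarrow> p x = p a + integral {a..x} q"
  shows "continuous_on {a..b} p"
proof -
  have "continuous_on {a..b} (\<lambda>x. p a + integral {a..x} q)"
    using assms(1) by (intro continuous_intros indefinite_integral_continuous_1 set_lebesgue_integral_eq_integral)
  then show ?thesis by (rule continuous_on_eq) (rule assms(2)[symmetric])
qed

text \<open>The product rule is the chain rule for the square, by polarization.\<close>

lemma integral_by_parts_test_fun:
  assumes q: "q absolutely_integrable_on {-1..1}"
    and p: "\<And>x. x \<in> {-1..1} \<Longrightarrow> p x = p (-1) + integral {-1..x} q"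
    and \<phi>: "test_fun \<phi>"
  shows "integral {-1..1} (\<lambda>x. p x * deriv \<phi> x) = - integral {-1..1} (\<lambda>x. q x * \<phi> x)"
proof -
  note \<phi>' = test_fun_facts[OF \<phi>]
  have pc: "continuous_on {-1..1} p"
    by (rule abs_int_primitive_continuous[OF q p])
  have i1: "(\<lambda>x. p x * deriv \<phi> x) integrable_on {-1..1}"
    by (intro integrable_continuous_real continuous_intros pc \<phi>')
  have i2: "(\<lambda>x. q x * \<phi> x) integrable_on {-1..1}"
    using absolutely_integrable_continuous_mult[OF q \<phi>'(3)]
    by (simp add: mult.commute set_lebesgue_integral_eq_integral)
  \<comment> \<open>Since \<phi> vanishes at both end points, the value of the integral does not
    depend on \<open>c\<close>; the difference of the cases 1 and -1 is four times the product
    rule.\<close>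
  have *: "((\<lambda>x. 2 * (p x + c * \<phi> x) * (q x + c * deriv \<phi> x)) has_integral (p 1)^2 - (p (-1))^2) {-1..1}" for c
  proof -
    have "((\<lambda>x. 2 * (p x + c * \<phi> x) * (q x + c * deriv \<phi> x)) has_integral
        (p 1 + c * \<phi> 1)^2 - (p (-1) + c * \<phi> (-1))^2) {-1..1}"
    proof (rule absolutely_continuous_chain_rule)
      show "(\<lambda>x. q x + c * deriv \<phi> x) absolutely_integrable_on {-1..1}"
        by (intro set_integral_add q absolutely_integrable_continuous_real continuous_intros \<phi>')
      show "((\<lambda>s. s^2) has_real_derivative 2 * s) (at s)" for s :: real
        by (auto intro!: derivative_eq_intros)
      fix x :: real assume x: "x \<in> {-1..1}"
      have "(deriv \<phi> has_integral \<phi> x - \<phi> (-1)) {-1..x}"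
        using x \<phi>'(1) by (intro fundamental_theorem_of_calculus)
          (auto simp: has_real_derivative_iff_has_vector_derivative[symmetric] intro: has_field_derivative_at_within)
      moreover have "(q has_integral p x - p (-1)) {-1..x}"
        using absolutely_integrable_on_subinterval[OF q, of "-1" x] x p[OF x]
        by (auto simp: has_integral_iff set_lebesgue_integral_eq_integral)
      ultimately have "((\<lambda>x. q x + c * deriv \<phi> x) has_integral (p x - p (-1)) + c * (\<phi> x - \<phi> (-1))) {-1..x}"
        by (intro has_integral_add has_integral_mult_right)
      then show "p x + c * \<phi> x = p (-1) + c * \<phi> (-1) + integral {-1..x} (\<lambda>x. q x + c * deriv \<phi> x)"
        by (simp add: integral_unique algebra_simps)
    qed (auto intro!: continuous_intros)
    with \<phi>'(4,5) show ?thesis by simp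
  qed
  have "((\<lambda>x. (2 * (p x + 1 * \<phi> x) * (q x + 1 * deriv \<phi> x) - 2 * (p x + (-1) * \<phi> x) * (q x + (-1) * deriv \<phi> x)) / 4)
     has_integral 0) {-1..1}"
    using has_integral_divide[OF has_integral_diff[OF *[of 1] *[of "-1"]], of 4] by simp
  also have "(\<lambda>x. (2 * (p x + 1 * \<phi> x) * (q x + 1 * deriv \<phi> x) - 2 * (p x + (-1) * \<phi> x) * (q x + (-1) * deriv \<phi> x)) / 4)
    = (\<lambda>x. p x * deriv \<phi> x + q x * \<phi> x)"
    by (auto simp: algebra_simps)
  finally have "integral {-1..1} (\<lambda>x. p x * deriv \<phi> x + q x * \<phi> x) = 0"
    by (rule integral_unique)
  then show ?thesis by (simp add: integral_add[OF i1 i2])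
qed

section \<open>Primitives of test functions and the du Bois-Reymond lemma\<close>

text \<open>The primitive itself is not placed in \<open>flat_alg\<close>, but from the first
  derivative on everything lies there.\<close>

lemma smooth_primitive:
  fixes f \<phi> :: "real \<Rightarrow> real"
  assumes "flat_alg f" "\<And>x. (\<phi> has_real_derivative f x) (at x)"
  shows "((deriv ^^ n) \<phi>) differentiable (at x)"
proof (cases n)
  case 0
  with assms(2) show ?thesis by (auto simp: real_differentiable_def)
next
  case (Suc k)
  have "deriv \<phi> = f" using assms(2) by (intro ext DERIV_imp_deriv)
  with Suc flat_alg_smooth[OF assms(1)] show ?thesis
    by (simp add: funpow_Suc_right del: funpow.simps)
qed

text \<open>Mean value zero is what makes the primitive vanish again to the right of the
  support.\<close>

lemma test_fun_primitive:
  assumes f: "flat_alg f" and supp: "-1 < a" "b < 1" "\<And>x. x \<notin> {a..b} \<Longrightarrow> f x = 0"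
    and zero: "integral {-1..1} f = 0"
  obtains \<phi> where "test_fun \<phi>" "deriv \<phi> = f"
proof
  \<comment> \<open>Starting at -2 leaves room to differentiate the integral on a neighbourhood of
    \<open>{-1..1}\<close>; at and to the left of -2 the function is constantly 0 nearby.\<close>
  define \<phi> where "\<phi> x = integral {-2..x} f" for x
  have fc: "continuous_on S f" for S by (rule flat_alg_continuous[OF f])
  have left: "\<phi> x = 0" if "x < a" for x
  proof -
    have "integral {-2..x} f = integral {-2..x} (\<lambda>_. 0)"
      by (rule Henstock_Kurzweil_Integration.integral_cong) (use that supp in auto)
    then show ?thesis by (simp add: \<phi>_def)
  qed
  have right: "\<phi> x = 0" if "x > b" for x
  proof -
    have e: "{y \<in> {-2..x} - {-1..1}. f y \<noteq> 0} = {}" "{y \<in> {-1..1} - {-2..x}. f y \<noteq> 0} = {}"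
      using supp that by fastforce+
    have "(f has_integral integral {-1..1} f) {-1..1}"
      by (intro integrable_integral integrable_continuous_real fc)
    then have "(f has_integral integral {-1..1} f) {-2..x}"
      by (subst has_integral_spike_set_eq) (simp_all only: e negligible_empty)
    then have "integral {-2..x} f = integral {-1..1} f"
      by (rule integral_unique)
    then show ?thesis by (simp add: \<phi>_def zero)
  qed
  have der: "(\<phi> has_real_derivative f x) (at x)" for x
  proof (cases "x > -2")
    case True
    have "((\<lambda>x. integral {-2..x} f) has_real_derivative f x) (at x within {-2..x+1})"
      using True by (intro integral_has_real_derivative fc) auto
    then show ?thesis
      using True unfolding \<phi>_def by (subst (asm) at_within_interior) auto
  next
    case False
    have "((\<lambda>_. 0) has_real_derivative 0) (at x)" by simp
    then have "(\<phi> has_real_derivative 0) (at x)"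
      by (rule has_field_derivative_transform_within_open[where S = "{..<a}"]) (use False supp left in auto)
    moreover have "f x = 0" using False supp by auto
    ultimately show ?thesis by simp
  qed
  show "deriv \<phi> = f" using der by (intro ext DERIV_imp_deriv)
  show "test_fun \<phi>"
    unfolding test_fun_def
  proof (intro conjI allI exI)
    show "(deriv ^^ n) \<phi> differentiable at x" for n x
      by (rule smooth_primitive[OF f der])
    show "x \<notin> {a..b} \<longrightarrow> \<phi> x = 0" for x using left right by auto
  qed (use supp in auto)
qed

text \<open>Subtracting from a test function the right multiple of the fixed bump
  \<open>cutoff 2\<close> leaves mean value zero, hence the derivative of a test function, to which
  \<open>f\<close> is orthogonal. So \<open>f\<close> minus a constant is orthogonal to all test
  functions of the algebra, and the fundamental lemma applies.\<close>

lemma du_Bois_Reymond: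
  assumes f: "f absolutely_integrable_on {-1..1}"
    and zero: "\<And>\<phi>. test_fun \<phi> \<Longrightarrow> integral {-1..1} (\<lambda>x. f x * deriv \<phi> x) = 0"
  obtains c where "negligible {x \<in> {-1..1}. f x \<noteq> c}"
proof -
  let ?k = "cutoff 2"
  define K where "K = integral {-1..1} ?k"
  have kc: "continuous_on S ?k" for S by (rule flat_alg_continuous[OF flat_alg_cutoff])
  have "K \<noteq> 0"
  proof
    assume "K = 0"
    then have "\<forall>x\<in>{-1..1}. ?k x = 0"
      unfolding K_def by (subst (asm) integral_eq_0_iff[OF kc]) (auto simp: cutoff_def flat_exp_bounds)
    then have "?k 0 = 0" by auto
    then show False by (simp add: cutoff_def flat_exp_def)
  qed
  have mult_int: "(\<lambda>x. f x * g x) integrable_on {-1..1}" if "flat_alg g" for g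
    using absolutely_integrable_continuous_mult[OF f flat_alg_continuous[OF that]]
    by (simp add: mult.commute set_lebesgue_integral_eq_integral)
  \<comment> \<open>The average of \<open>f\<close> with weight \<open>cutoff 2\<close>, the only
    possible value of the constant.\<close>
  define c where "c = integral {-1..1} (\<lambda>x. f x * ?k x) / K"
  have "negligible {x \<in> {-1..1}. f x - c \<noteq> 0}"
  proof (rule fundamental_lemma)
    show "(\<lambda>x. f x - c) absolutely_integrable_on {-1..1}"
      by (intro set_integral_diff f) (auto intro: absolutely_integrable_continuous_real)
    fix \<eta> assume \<eta>: "flat_alg \<eta>" "test_fun \<eta>"
    then obtain a b where ab: "-1 < a" "b < 1" "\<And>x. x \<notin> {a..b} \<Longrightarrow> \<eta> x = 0"
      unfolding test_fun_def by blast
    define d where "d = integral {-1..1} \<eta> / K"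
    define \<zeta> where "\<zeta> x = \<eta> x + (- d) * ?k x" for x
    have \<zeta>: "flat_alg \<zeta>"
      unfolding \<zeta>_def by (intro flat_alg.add flat_alg.mult flat_alg.const \<eta> flat_alg_cutoff)
    have \<eta>i: "\<eta> integrable_on {-1..1}" and ki: "?k integrable_on {-1..1}"
      by (intro integrable_continuous_real flat_alg_continuous \<eta> flat_alg_cutoff)+
    have "integral {-1..1} \<zeta> = integral {-1..1} \<eta> + (- d) * K"
      unfolding \<zeta>_def K_def using \<eta>i ki by (subst integral_add) (auto intro: integrable_neg integrable_on_mult_right)
    then have "integral {-1..1} \<zeta> = 0" using \<open>K \<noteq> 0\<close> by (simp add: d_def)
    then obtain \<phi> where "test_fun \<phi>" "deriv \<phi> = \<zeta>"
    \<comment> \<open>The support interval of \<eta> is enlarged to contain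
      \<open>{-1/2..1/2}\<close>, outside which \<open>cutoff 2\<close> vanishes.\<close>
    proof (rule test_fun_primitive[OF \<zeta>, of "min a (-1/2)" "max b (1/2)", rotated 3])
      fix x assume "x \<notin> {min a (-1/2)..max b (1/2)}"
      then have "x \<notin> {a..b}" "x \<notin> {-1/2..1/2}" by auto
      then show "\<zeta> x = 0" using ab(3) cutoff_eq_0[of 2 x] by (auto simp: \<zeta>_def)
    qed (use ab in auto)
    with zero have "0 = integral {-1..1} (\<lambda>x. f x * \<zeta> x)" by metis
    also have "\<dots> = integral {-1..1} (\<lambda>x. f x * \<eta> x + (- d) * (f x * ?k x))"
      by (simp add: \<zeta>_def algebra_simps)
    also have "\<dots> = integral {-1..1} (\<lambda>x. f x * \<eta> x) + (- d) * integral {-1..1} (\<lambda>x. f x * ?k x)"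
      using mult_int[OF \<eta>(1)] mult_int[OF flat_alg_cutoff[of 2]]
      by (subst integral_add) (auto intro: integrable_neg integrable_on_mult_right)
    also have "(- d) * integral {-1..1} (\<lambda>x. f x * ?k x) = (- c) * integral {-1..1} \<eta>"
      by (simp add: c_def d_def)
    also have "integral {-1..1} (\<lambda>x. f x * \<eta> x) + (- c) * integral {-1..1} \<eta>
        = integral {-1..1} (\<lambda>x. f x * \<eta> x + (- c) * \<eta> x)"
      using mult_int[OF \<eta>(1)] \<eta>i by (subst integral_add) (auto intro: integrable_neg integrable_on_mult_right)
    finally show "integral {-1..1} (\<lambda>x. (f x - c) * \<eta> x) = 0"
      by (simp add: algebra_simps)
  qed
  then show ?thesis by (intro that[of c]) simp
qed

section \<open>Representatives of Sobolev functions by iterated integrals\<close>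

text \<open>Fixes the absolutely continuous representative \<open>v\<close> of the first derivative,
  so that its values at single points, such as a critical point of \<open>u\<close>, make
  sense.\<close>

definition W22_rep :: "(real \<Rightarrow> real) \<Rightarrow> (real \<Rightarrow> real) \<Rightarrow> (real \<Rightarrow> real) \<Rightarrow> bool" where
  "W22_rep u v w \<longleftrightarrow> w absolutely_integrable_on {-1..1} \<and> (\<lambda>x. (w x)\<^sup>2) integrable_on {-1..1} \<and>
     (\<forall>x\<in>{-1..1}. v x = v (-1) + integral {-1..x} w) \<and>
     (\<forall>x\<in>{-1..1}. u x = u (-1) + integral {-1..x} v)"

lemma absolutely_integrable_Ioo_iff:
  "(f absolutely_integrable_on {a<..<b}) = (f absolutely_integrable_on {a..b})" for f :: "real \<Rightarrow> real"
  using absolutely_integrable_on_open_interval[of a b f] by simp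

lemma L2_I_iff: "L2_I f \<longleftrightarrow> f absolutely_integrable_on {-1..1} \<and> (\<lambda>x. (f x)\<^sup>2) integrable_on {-1..1}"
  by (simp add: L2_I_def absolutely_integrable_Ioo_iff integrable_on_open_interval_real)

lemma weak_deriv_iff: "weak_deriv u v \<longleftrightarrow> (\<forall>\<phi>. test_fun \<phi> \<longrightarrow>
    integral {-1..1} (\<lambda>x. u x * deriv \<phi> x) = - integral {-1..1} (\<lambda>x. v x * \<phi> x))"
  by (simp add: weak_deriv_def integral_open_interval_real)

lemma L2_I_continuous: "continuous_on {-1..1} f \<Longrightarrow> L2_I f"
  by (auto simp: L2_I_iff intro!: absolutely_integrable_continuous_real integrable_continuous_real continuous_intros)

lemma weak_deriv_unique:
  assumes "L2_I v" "L2_I w" "weak_deriv u v" "weak_deriv u w"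
  shows "negligible {x \<in> {-1..1}. v x \<noteq> w x}"
proof -
  have "negligible {x \<in> {-1..1}. v x - w x \<noteq> 0}"
  proof (rule fundamental_lemma)
    show "(\<lambda>x. v x - w x) absolutely_integrable_on {-1..1}"
      using assms by (intro set_integral_diff) (auto simp: L2_I_iff)
    fix \<phi> assume \<phi>: "flat_alg \<phi>" "test_fun \<phi>"
    have "(\<lambda>x. f x * \<phi> x) integrable_on {-1..1}" if "L2_I f" for f
      using absolutely_integrable_continuous_mult[where f = f, OF _ flat_alg_continuous[OF \<phi>(1)]] that
      by (simp add: L2_I_iff mult.commute set_lebesgue_integral_eq_integral)
    from this[OF assms(1)] this[OF assms(2)] assms(3,4) \<phi>(2)
    show "integral {-1..1} (\<lambda>x. (v x - w x) * \<phi> x) = 0"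
      by (simp add: left_diff_distrib integral_diff weak_deriv_iff)
  qed
  then show ?thesis by simp
qed

lemma weak_deriv_cong:
  assumes "weak_deriv u v" "negligible {x \<in> {-1..1}. u x \<noteq> u' x}"
  shows "weak_deriv u' v"
  unfolding weak_deriv_iff
proof (intro allI impI)
  fix \<phi> assume "test_fun \<phi>"
  moreover have "integral {-1..1} (\<lambda>x. u x * deriv \<phi> x) = integral {-1..1} (\<lambda>x. u' x * deriv \<phi> x)"
    by (rule integral_spike[OF assms(2)]) auto
  ultimately show "integral {-1..1} (\<lambda>x. u' x * deriv \<phi> x) = - integral {-1..1} (\<lambda>x. v x * \<phi> x)"
    using assms(1) by (simp add: weak_deriv_iff)
qed

text \<open>By parts, the primitive of \<open>w\<close> has weak derivative \<open>w\<close> too, so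
  its difference from \<open>v\<close> has weak derivative 0 and is constant by the du Bois-Reymond
  lemma.\<close>

lemma weak_deriv_imp_primitive:
  assumes v: "v absolutely_integrable_on {-1..1}" and w: "w absolutely_integrable_on {-1..1}"
    and vw: "weak_deriv v w"
  obtains c where "negligible {x \<in> {-1..1}. v x \<noteq> c + integral {-1..x} w}"
proof -
  let ?P = "\<lambda>x. integral {-1..x} w"
  have Pc: "continuous_on {-1..1} ?P"
    using w by (intro indefinite_integral_continuous_1 set_lebesgue_integral_eq_integral)
  have vP: "(\<lambda>x. v x - ?P x) absolutely_integrable_on {-1..1}"
    by (intro set_integral_diff v absolutely_integrable_continuous_real Pc)
  moreover have "integral {-1..1} (\<lambda>x. (v x - ?P x) * deriv \<phi> x) = 0" if \<phi>: "test_fun \<phi>" for \<phi>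
  proof -
    have i: "(\<lambda>x. f x * deriv \<phi> x) integrable_on {-1..1}" if "f absolutely_integrable_on {-1..1}" for f
      using absolutely_integrable_continuous_mult[where f = f, OF that test_fun_facts(2)[OF \<phi>]]
      by (simp add: mult.commute set_lebesgue_integral_eq_integral)
    have "integral {-1..1} (\<lambda>x. ?P x * deriv \<phi> x) = - integral {-1..1} (\<lambda>x. w x * \<phi> x)"
      by (rule integral_by_parts_test_fun[OF w _ \<phi>]) auto
    with i[OF v] i[OF absolutely_integrable_continuous_real[OF Pc]] vw \<phi> show ?thesis
      by (simp add: left_diff_distrib integral_diff weak_deriv_iff)
  qed
  ultimately obtain c where "negligible {x \<in> {-1..1}. v x - ?P x \<noteq> c}"
    by (rule du_Bois_Reymond)
  then show ?thesis by (intro that[of c]) (simp add: algebra_simps)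
qed

lemma continuous_eq_if_ae_eq:
  fixes f g :: "real \<Rightarrow> real"
  assumes "continuous_on {a..b} f" "continuous_on {a..b} g" "a < b"
    and "negligible {x \<in> {a..b}. f x \<noteq> g x}" "x \<in> {a..b}"
  shows "f x = g x"
proof -
  have "integral {a..b} (\<lambda>x. \<bar>f x - g x\<bar>) = integral {a..b} (\<lambda>x. 0::real)"
    by (rule integral_spike[OF assms(4)]) auto
  moreover have "continuous_on {a..b} (\<lambda>x. \<bar>f x - g x\<bar>)"
    by (intro continuous_intros assms)
  ultimately have "\<forall>x\<in>{a..b}. \<bar>f x - g x\<bar> = 0"
    using assms(3) by (simp add: integral_eq_0_iff)
  with assms(5) show ?thesis by simp
qed

lemma W22_rep_facts:
  assumes "W22_rep u v w"
  shows "w absolutely_integrable_on {-1..1}" "(\<lambda>x. (w x)\<^sup>2) integrable_on {-1..1}"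
    "continuous_on {-1..1} v" "continuous_on {-1..1} u"
    "x \<in> {-1..1} \<Longrightarrow> (u has_real_derivative v x) (at x within {-1..1})"
proof -
  note r = assms[unfolded W22_rep_def]
  show w: "w absolutely_integrable_on {-1..1}" "(\<lambda>x. (w x)\<^sup>2) integrable_on {-1..1}"
    using r by blast+
  show v: "continuous_on {-1..1} v"
    by (rule abs_int_primitive_continuous[OF w(1)]) (use r in blast)
  show "continuous_on {-1..1} u"
    by (rule abs_int_primitive_continuous[OF absolutely_integrable_continuous_real[OF v]]) (use r in blast)
  assume x: "x \<in> {-1..1}"
  have "((\<lambda>x. u (-1) + integral {-1..x} v) has_real_derivative 0 + v x) (at x within {-1..1})"
    by (intro DERIV_add integral_has_real_derivative v x) auto
  then have "((\<lambda>x. u (-1) + integral {-1..x} v) has_real_derivative v x) (at x within {-1..1})"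
    by simp
  then show "(u has_real_derivative v x) (at x within {-1..1})"
    by (rule has_field_derivative_transform_within[OF _ zero_less_one x])
      (rule bspec[OF conjunct2[OF conjunct2[OF conjunct2[OF r]]], symmetric])
qed

text \<open>The primitive lemma is applied twice: to \<open>v\<close> and \<open>w\<close> it gives
  the representative \<open>v'\<close>, to \<open>u\<close> and \<open>v\<close> it gives
  \<open>u\<close> as a primitive almost everywhere, and then everywhere by continuity.\<close>

lemma weak_deriv_imp_W22_rep:
  assumes u: "continuous_on {-1..1} u" and v: "L2_I v" and w: "L2_I w"
    and uv: "weak_deriv u v" and vw: "weak_deriv v w"
  obtains v' where "W22_rep u v' w" "negligible {x \<in> {-1..1}. v x \<noteq> v' x}"
proof -
  have vi: "v absolutely_integrable_on {-1..1}" and wi: "w absolutely_integrable_on {-1..1}"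
    using v w by (auto simp: L2_I_iff)
  obtain c where c: "negligible {x \<in> {-1..1}. v x \<noteq> c + integral {-1..x} w}"
    by (rule weak_deriv_imp_primitive[OF vi wi vw])
  define v' where "v' x = c + integral {-1..x} w" for x
  have v'c: "continuous_on {-1..1} v'"
    unfolding v'_def using wi by (intro continuous_intros indefinite_integral_continuous_1 set_lebesgue_integral_eq_integral)
  obtain d where d: "negligible {x \<in> {-1..1}. u x \<noteq> d + integral {-1..x} v}"
    by (rule weak_deriv_imp_primitive[OF absolutely_integrable_continuous_real[OF u] vi uv])
  have veq: "integral {-1..x} v = integral {-1..x} v'" if "x \<in> {-1..1}" for x
    by (rule integral_spike[OF c]) (use that in \<open>auto simp: v'_def\<close>)
  have ueq: "u x = d + integral {-1..x} v" if "x \<in> {-1..1}" for x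
    by (rule continuous_eq_if_ae_eq[OF u _ _ d that])
      (use vi in \<open>auto intro!: continuous_intros indefinite_integral_continuous_1 set_lebesgue_integral_eq_integral\<close>)
  have "W22_rep u v' w"
    unfolding W22_rep_def
  proof (intro conjI ballI)
    fix x :: real assume x: "x \<in> {-1..1}"
    show "v' x = v' (-1) + integral {-1..x} w" by (simp add: v'_def)
    have "u (-1) = d" using ueq[of "-1"] by simp
    then show "u x = u (-1) + integral {-1..x} v'"
      using ueq[OF x] veq[OF x] by simp
  qed (use w in \<open>auto simp: L2_I_iff\<close>)
  moreover have "negligible {x \<in> {-1..1}. v x \<noteq> v' x}" using c by (simp add: v'_def)
  ultimately show ?thesis by (rule that)
qed

lemma W22_rep_imp_weak_deriv:
  assumes "W22_rep u v w"
  shows "L2_I v" "L2_I w" "weak_deriv u v" "weak_deriv v w"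
proof -
  note r = assms[unfolded W22_rep_def] and f = W22_rep_facts[OF assms]
  show "L2_I v" by (rule L2_I_continuous[OF f(3)])
  show "L2_I w" using f(1,2) by (simp add: L2_I_iff)
  show "weak_deriv u v"
    unfolding weak_deriv_iff
    by (intro allI impI integral_by_parts_test_fun absolutely_integrable_continuous_real f) (use r in blast)+
  show "weak_deriv v w"
    unfolding weak_deriv_iff by (intro allI impI integral_by_parts_test_fun f) (use r in blast)+
qed

lemma W22_iff: "W22 u \<longleftrightarrow> (\<exists>v w. W22_rep u v w)"
proof
  assume "W22 u"
  then show "\<exists>v w. W22_rep u v w"
    unfolding W22_def by (metis weak_deriv_imp_W22_rep)
next
  assume "\<exists>v w. W22_rep u v w"
  then obtain v w where r: "W22_rep u v w" by blast
  with W22_rep_imp_weak_deriv[OF r] W22_rep_facts(4)[OF r] show "W22 u"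
    unfolding W22_def by (auto intro: L2_I_continuous)
qed

section \<open>Lower bounds for the energy\<close>

definition curvature_energy :: "real set \<Rightarrow> (real \<Rightarrow> real) \<Rightarrow> (real \<Rightarrow> real) \<Rightarrow> real" where
  "curvature_energy S v w = integral S (\<lambda>x. (w x)\<^sup>2 * (1 + (v x)\<^sup>2) powr (-5/2))"

text \<open>The choice operator in \<open>Bfun\<close> is harmless: weak derivatives are unique up
  to null sets, which the integral does not see.\<close>

lemma Bfun_eq:
  assumes r: "W22_rep u v w"
  shows "Bfun u = curvature_energy {-1..1} v w"
  unfolding Bfun_def
proof (rule some_equality)
  note wd = W22_rep_imp_weak_deriv[OF r]
  show "\<exists>v' w'. L2_I v' \<and> L2_I w' \<and> weak_deriv u v' \<and> weak_deriv v' w' \<and>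
       curvature_energy {-1..1} v w = integral I_int (\<lambda>x. (w' x)\<^sup>2 * (1 + (v' x)\<^sup>2) powr (-5/2))"
    using wd unfolding curvature_energy_def integral_open_interval_real by blast
  fix b assume "\<exists>v w. L2_I v \<and> L2_I w \<and> weak_deriv u v \<and> weak_deriv v w \<and>
        b = integral I_int (\<lambda>x. (w x)\<^sup>2 * (1 + (v x)\<^sup>2) powr (-5/2))"
  then obtain v' w' where w': "L2_I v'" "L2_I w'" "weak_deriv u v'" "weak_deriv v' w'"
    "b = integral {-1..1} (\<lambda>x. (w' x)\<^sup>2 * (1 + (v' x)\<^sup>2) powr (-5/2))"
    unfolding integral_open_interval_real by blast
  have n1: "negligible {x \<in> {-1..1}. v' x \<noteq> v x}"
    by (rule weak_deriv_unique[OF w'(1) wd(1) w'(3) wd(3)])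
  have n2: "negligible {x \<in> {-1..1}. w' x \<noteq> w x}"
    by (rule weak_deriv_unique[OF w'(2) wd(2) weak_deriv_cong[OF w'(4) n1] wd(4)])
  show "b = curvature_energy {-1..1} v w"
    unfolding w'(5) curvature_energy_def
    by (rule integral_spike[OF negligible_Un[OF n1 n2]]) auto
qed

text \<open>Allows estimates to be proved only to the right of a point; the part to the left is the
  right part of the reflected function.\<close>

lemma W22_rep_reflect:
  assumes "W22_rep u v w"
  shows "W22_rep (\<lambda>x. u (- x)) (\<lambda>x. - v (- x)) (\<lambda>x. w (- x))"
proof -
  note r = assms[unfolded W22_rep_def] and f = W22_rep_facts[OF assms]
  have *: "f (- x) = f 1 - integral {-1..x} (\<lambda>x. g (- x))"
    if "g integrable_on {-1..1}" "\<forall>x\<in>{-1..1}. f x = f (-1) + integral {-1..x} g" "x \<in> {-1..1}"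
    for f g :: "real \<Rightarrow> real" and x
  proof -
    have "integral {-1..x} (\<lambda>x. g (- x)) = integral {-x..1} g"
      using Henstock_Kurzweil_Integration.integral_reflect_real[of 1 "-x" g] by simp
    moreover have "integral {-1..-x} g + integral {-x..1} g = integral {-1..1} g"
      by (rule Henstock_Kurzweil_Integration.integral_combine) (use that in auto)
    ultimately show ?thesis using that(2)[rule_format, of 1] that(2)[rule_format, of "-x"] that(3) by auto
  qed
  have wi: "w integrable_on {-1..1}" using f(1) by (simp add: set_lebesgue_integral_eq_integral)
  have vi: "v integrable_on {-1..1}" by (intro integrable_continuous_real f)
  show ?thesis
    unfolding W22_rep_def
  proof (intro conjI ballI)
    show "(\<lambda>x. w (- x)) absolutely_integrable_on {-1..1}"
      using f(1) Henstock_Kurzweil_Integration.integrable_reflect_real[where f = "\<lambda>x. norm (w x)" and a = "-1" and b = 1] Henstock_Kurzweil_Integration.integrable_reflect_real[where f = w and a = "-1" and b = 1]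
      by (simp add: absolutely_integrable_on_def)
    show "(\<lambda>x. (w (- x))\<^sup>2) integrable_on {-1..1}"
      using f(2) Henstock_Kurzweil_Integration.integrable_reflect_real[where f = "\<lambda>x. (w x)^2" and a = "-1" and b = 1] by simp
    fix x :: real assume x: "x \<in> {-1..1}"
    show "- v (- x) = - v (- (-1)) + integral {-1..x} (\<lambda>x. w (- x))"
      using *[OF wi conjunct1[OF conjunct2[OF conjunct2[OF r]]] x] by simp
    show "u (- x) = u (- (-1)) + integral {-1..x} (\<lambda>x. - v (- x))"
      using *[OF vi conjunct2[OF conjunct2[OF conjunct2[OF r]]] x] by simp
  qed
qed

section \<open>The integral of the square root of the sine, and the dual energy\<close>

text \<open>The lower limit \<open>-4 < -pi\<close> makes the derivative formula valid at every angle that occurs, and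
  since Isabelle's \<open>sqrt\<close> is odd, the integrand is continuous where \<open>sin\<close> is negative.\<close>

definition sqsin :: "real \<Rightarrow> real" where
  "sqsin x = integral {-4..x} (\<lambda>t. sqrt (sin t)) - integral {-4..0} (\<lambda>t. sqrt (sin t))"

lemma sqsin_0 [simp]: "sqsin 0 = 0"
  by (simp add: sqsin_def)

lemma sqsin_has_derivative:
  assumes "x > -4"
  shows "(sqsin has_real_derivative sqrt (sin x)) (at x)"
proof -
  have "((\<lambda>x. integral {-4..x} (\<lambda>t. sqrt (sin t)) - integral {-4..0} (\<lambda>t. sqrt (sin t)))
      has_real_derivative sqrt (sin x) - 0) (at x within {-4..x+1})"
    using assms by (intro DERIV_diff integral_has_real_derivative continuous_intros) auto
  then show ?thesis
    unfolding sqsin_def[abs_def] using assms by (subst (asm) at_within_interior) auto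
qed

lemmas sqsin_has_derivative' = DERIV_chain2[OF sqsin_has_derivative]

lemma sqsin_strict_mono:
  assumes "0 \<le> x" "x < y" "y \<le> pi"
  shows "sqsin x < sqsin y"
proof (rule DERIV_pos_imp_increasing_open[OF assms(2)])
  fix t assume "x < t" "t < y"
  with assms have "sin t > 0" "t > -4" by (auto intro: sin_gt_zero)
  then show "\<exists>d. (sqsin has_real_derivative d) (at t) \<and> d > 0"
    using sqsin_has_derivative[of t] by auto
next
  show "continuous_on {x..y} sqsin"
    using assms by (intro continuous_at_imp_continuous_on ballI DERIV_isCont[OF sqsin_has_derivative]) auto
qed

lemma sqsin_pos: "0 < x \<Longrightarrow> x \<le> pi \<Longrightarrow> sqsin x > 0"
  using sqsin_strict_mono[of 0 x] by simp

lemma sqsin_continuous: "continuous_on {0..} sqsin"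
  by (intro continuous_at_imp_continuous_on ballI DERIV_isCont[OF sqsin_has_derivative]) auto

lemma sqsin_half_pi: "sqsin (pi/2) = c_star"
proof -
  have "((\<lambda>\<phi>. sqrt (cos \<phi>)) has_integral (- sqsin (pi/2 - pi/2) - - sqsin (pi/2 - 0))) {0..pi/2}"
  proof (rule fundamental_theorem_of_calculus)
    fix \<phi> :: real assume "\<phi> \<in> {0..pi/2}"
    then have "((\<lambda>\<phi>. - sqsin (pi/2 - \<phi>)) has_real_derivative sqrt (cos \<phi>)) (at \<phi>)"
      by (auto intro!: derivative_eq_intros sqsin_has_derivative' simp: sin_diff)
    then show "((\<lambda>\<phi>. - sqsin (pi/2 - \<phi>)) has_vector_derivative sqrt (cos \<phi>)) (at \<phi> within {0..pi/2})"
      by (simp add: has_real_derivative_iff_has_vector_derivative has_vector_derivative_at_within)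
  qed simp
  then show ?thesis by (simp add: c_star_def integral_unique)
qed

text \<open>On the interval in question cos \<phi> is at most its square root, and its integral is
  1. The consequence \<open>h_star \<le> 2\<close> brings all low obstacles into the range of
  \<open>multiplier_strict_mono\<close>.\<close>

lemma c_star_ge_1: "c_star \<ge> 1"
proof -
  have "(cos has_integral (sin (pi/2) - sin 0)) {0..pi/2}"
    by (rule fundamental_theorem_of_calculus)
      (auto intro!: derivative_eq_intros has_vector_derivative_at_within
        simp flip: has_real_derivative_iff_has_vector_derivative)
  moreover have "((\<lambda>\<phi>. sqrt (cos \<phi>)) has_integral c_star) {0..pi/2}"
    unfolding c_star_def by (intro integrable_integral integrable_continuous_real continuous_intros)
  moreover have "cos \<phi> \<le> sqrt (cos \<phi>)" if "\<phi> \<in> {0..pi/2}" for \<phi> :: real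
  proof (rule real_le_rsqrt)
    have "cos \<phi> \<ge> 0" using that by (auto intro: cos_ge_zero)
    then show "(cos \<phi>)\<^sup>2 \<le> cos \<phi>"
      using mult_left_mono[of "cos \<phi>" 1 "cos \<phi>"] by (simp add: power2_eq_square)
  qed
  ultimately have "sin (pi/2) - sin 0 \<le> c_star"
    by (rule has_integral_le)
  then show ?thesis by simp
qed

lemma sin_cos_pos: "0 < x \<Longrightarrow> x < pi/2 \<Longrightarrow> sin x > 0 \<and> cos x > 0"
  by (auto intro: sin_gt_zero cos_gt_zero)

text \<open>With s = sin t and c = cos t, the derivative has the sign of c^2 + 2 s^2 - h c s, which
  for h \<le> 2 is at least (c - s)^2 + s^2 > 0.\<close>

lemma multiplier_strict_mono:
  assumes h: "0 \<le> h" "h \<le> 2" and xy: "0 < x" "x < y" "y < pi/2"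
  shows "sqrt (sin x) / (cos x + h * sin x) < sqrt (sin y) / (cos y + h * sin y)"
proof (rule DERIV_pos_imp_increasing[OF xy(2)])
  fix t assume t: "x \<le> t" "t \<le> y"
  define s c where "s = sin t" "c = cos t"
  have pos: "s > 0" "c > 0" using sin_cos_pos[of t] t xy by (auto simp: s_c_def)
  have D: "c + h * s > 0" using pos h by (intro add_pos_nonneg) auto
  let ?d = "(c / (2 * sqrt s) * (c + h * s) - sqrt s * (- s + h * c)) / (c + h * s)\<^sup>2"
  have "((\<lambda>t. sqrt (sin t) / (cos t + h * sin t)) has_real_derivative ?d) (at t)"
    using pos D unfolding s_c_def
    by (auto intro!: derivative_eq_intros simp: divide_simps power2_eq_square)
  moreover have "?d > 0"
  proof -
    have "h * (c * s) \<le> 2 * (c * s)" using h pos by (intro mult_right_mono) auto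
    moreover have "(c - s)\<^sup>2 \<ge> 0" "s\<^sup>2 > 0" using pos by auto
    ultimately have "c * (c + h * s) - 2 * s * (- s + h * c) > 0"
      by (simp add: power2_eq_square algebra_simps)
    moreover have "c / (2 * r) * d - r * e = (c * d - 2 * (r * r) * e) / (2 * r)" if "r > 0" for r d e
      using that by (simp add: field_simps)
    note this[of "sqrt s" "c + h * s" "- s + h * c"]
    ultimately show ?thesis using pos D by simp
  qed
  ultimately show "\<exists>d. ((\<lambda>t. sqrt (sin t) / (cos t + h * sin t)) has_real_derivative d) (at t) \<and> 0 < d"
    by blast
qed

text \<open>The calibration bound: multiplier \<open>\<mu>\<close>, interval length \<open>l\<close>, height \<open>H\<close>, steepest angle \<open>\<beta>\<close>.\<close>

definition dual_energy :: "real \<Rightarrow> real \<Rightarrow> real \<Rightarrow> real \<Rightarrow> real" where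
  "dual_energy \<mu> l H \<beta> = 2 * \<mu> * sqsin \<beta> - \<mu>\<^sup>2 * (l * sin \<beta> - H * cos \<beta>)"

text \<open>With \<open>?k\<close> the increasing function of \<open>multiplier_strict_mono\<close>
  and \<mu> = 2 \<open>?k \<alpha>\<close>, the derivative in the angle t is a positive factor times
  \<open>?k t - ?k \<alpha>\<close>. So it is negative before \<alpha> and positive after
  it.\<close>

lemma dual_energy_strict_min:
  assumes h: "0 \<le> h" "h \<le> 2" and a: "0 < \<alpha>" "\<alpha> < pi/2" and b: "0 < \<beta>" "\<beta> < pi/2" and ne: "\<beta> \<noteq> \<alpha>"
    and mu: "\<mu> = 2 * sqrt (sin \<alpha>) / (cos \<alpha> + h * sin \<alpha>)"
  shows "dual_energy \<mu> 1 h \<alpha> < dual_energy \<mu> 1 h \<beta>"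
proof -
  let ?k = "\<lambda>t. sqrt (sin t) / (cos t + h * sin t)"
  let ?V' = "\<lambda>t. 2 * \<mu> * sqrt (sin t) - \<mu>\<^sup>2 * (cos t + h * sin t)"
  have D: "cos t + h * sin t > 0" if "0 < t" "t < pi/2" for t
    using sin_cos_pos[OF that] h by (intro add_pos_nonneg) auto
  have mu0: "\<mu> > 0" using sin_cos_pos[OF a] D[OF a] by (simp add: mu)
  have V': "((\<lambda>t. dual_energy \<mu> 1 h t) has_real_derivative ?V' t) (at t)" if "0 < t" for t
    unfolding dual_energy_def using that
    by (auto intro!: derivative_eq_intros sqsin_has_derivative' simp: algebra_simps)
  have fact: "?V' t = 2 * \<mu> * (cos t + h * sin t) * (?k t - ?k \<alpha>)" if "0 < t" "t < pi/2" for t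
  proof -
    have *: "2 * \<mu> * d * (x - y) = 2 * \<mu> * (d * x) - \<mu> * d * (2 * y)" for d x y
      by (simp add: algebra_simps)
    have "2 * \<mu> * (cos t + h * sin t) * (?k t - ?k \<alpha>) = 2 * \<mu> * ((cos t + h * sin t) * ?k t) - \<mu> * (cos t + h * sin t) * (2 * ?k \<alpha>)"
      using *[of "cos t + h * sin t" "?k t" "?k \<alpha>"] .
    also have "(cos t + h * sin t) * ?k t = sqrt (sin t)" using D[OF that] by simp
    also have "2 * ?k \<alpha> = \<mu>" by (simp add: mu)
    finally show ?thesis by (simp add: power2_eq_square)
  qed
  consider "\<alpha> < \<beta>" | "\<beta> < \<alpha>" using ne by linarith
  then show ?thesis
  proof cases
    case 1
    then obtain z where z: "\<alpha> < z" "z < \<beta>" "dual_energy \<mu> 1 h \<beta> - dual_energy \<mu> 1 h \<alpha> = (\<beta> - \<alpha>) * ?V' z"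
      using MVT2[of \<alpha> \<beta> "dual_energy \<mu> 1 h" ?V'] V' a by auto
    have "?V' z > 0" using z a b mu0 D[of z] multiplier_strict_mono[OF h a(1) z(1)] by (subst fact) auto
    then have "(\<beta> - \<alpha>) * ?V' z > 0" using 1 by (intro mult_pos_pos) auto
    with z show ?thesis by linarith
  next
    case 2
    then obtain z where z: "\<beta> < z" "z < \<alpha>" "dual_energy \<mu> 1 h \<alpha> - dual_energy \<mu> 1 h \<beta> = (\<alpha> - \<beta>) * ?V' z"
      using MVT2[of \<beta> \<alpha> "dual_energy \<mu> 1 h" ?V'] V' b by auto
    have "?V' z < 0" using z a b mu0 D[of z] multiplier_strict_mono[OF h _ z(2) a(2)] by (subst fact) (auto intro!: mult_pos_neg)
    then have "(\<alpha> - \<beta>) * ?V' z < 0" using 2 by (intro mult_pos_neg) auto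
    with z show ?thesis by linarith
  qed
qed

text \<open>The right-hand side decreases strictly up to pi/2, where it equals
  \<open>c_star\<close>. In its derivative the 1 from the first quotient cancels against the 1 in
  1/sin^2 = 1 + cot^2, and two negative terms remain.\<close>

lemma sqsin_cot_bound:
  assumes b: "0 < \<beta>" "\<beta> < pi/2"
  shows "c_star < sqsin \<beta> / sqrt (sin \<beta>) + cos \<beta> / sin \<beta>"
proof -
  let ?f = "\<lambda>t. sqsin t / sqrt (sin t) + cos t / sin t"
  have "?f (pi/2) < ?f \<beta>"
  proof (rule DERIV_neg_imp_decreasing_open[OF b(2)])
    fix t assume t: "\<beta> < t" "t < pi/2"
    define s c where "s = sin t" "c = cos t"
    have pos: "s > 0" "c > 0" using sin_cos_pos[of t] t b by (auto simp: s_c_def)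
    have sc: "s\<^sup>2 + c\<^sup>2 = 1" by (simp add: s_c_def)
    have Y: "sqsin t > 0" using t b by (intro sqsin_pos) auto
    let ?d = "(sqrt s * sqrt s - sqsin t * (c / (2 * sqrt s))) / (sqrt s * sqrt s) + (- s * s - c * c) / (s * s)"
    have root: "((\<lambda>t. sqrt (sin t)) has_real_derivative c / (2 * sqrt s)) (at t)"
      using pos unfolding s_c_def by (auto intro!: derivative_eq_intros simp: field_simps)
    have "(?f has_real_derivative (sqrt (sin t) * sqrt (sin t) - sqsin t * (c / (2 * sqrt s))) / (sqrt (sin t) * sqrt (sin t))
        + (- sin t * sin t - cos t * cos t) / (sin t * sin t)) (at t)"
      using pos t b unfolding s_c_def
      by (intro DERIV_add DERIV_divide DERIV_sin DERIV_cos sqsin_has_derivative root[unfolded s_c_def]) auto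
    then have "(?f has_real_derivative ?d) (at t)"
      by (simp add: s_c_def)
    moreover have "?d < 0"
    proof -
      have "?d = 1 - sqsin t * (c / (2 * sqrt s)) / s - (s\<^sup>2 + c\<^sup>2) / s\<^sup>2"
        using pos by (simp add: field_simps power2_eq_square)
      also have "\<dots> = - (sqsin t * (c / (2 * sqrt s)) / s) - c\<^sup>2 / s\<^sup>2"
        using pos by (simp add: field_simps)
      also have "\<dots> < 0"
      proof -
        have "sqsin t * (c / (2 * sqrt s)) / s > 0" "c\<^sup>2 / s\<^sup>2 > 0" using pos Y by auto
        then show ?thesis by linarith
      qed
      finally show ?thesis .
    qed
    ultimately show "\<exists>d. (?f has_real_derivative d) (at t) \<and> d < 0" by blast
  next
    have "sin t \<noteq> 0" if "t \<in> {\<beta>..pi/2}" for t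
      using sin_gt_zero[of t] that b by auto
    then show "continuous_on {\<beta>..pi/2} ?f"
      using b by (intro continuous_intros continuous_on_subset[OF sqsin_continuous]) auto
  qed
  then show ?thesis by (simp add: sqsin_half_pi)
qed

section \<open>The calibration inequality\<close>

text \<open>The square root of the weight in the energy: u'' times this density at u' is the
  curvature times the square root of the length element ds/dx.\<close>

definition elastic_density :: "real \<Rightarrow> real" where
  "elastic_density s = (1 + s\<^sup>2) powr (-5/4)"

lemma elastic_density_pos: "elastic_density s > 0"
proof -
  have "1 + s\<^sup>2 > 0" by (simp add: add_pos_nonneg)
  then show ?thesis by (simp add: elastic_density_def)
qed

lemma elastic_density_square: "(elastic_density s)\<^sup>2 = (1 + s\<^sup>2) powr (-5/2)"
  by (simp add: elastic_density_def power2_eq_square powr_add[symmetric])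

lemma elastic_density_continuous:
  "continuous_on S f \<Longrightarrow> continuous_on S (\<lambda>x. elastic_density (f x))"
  unfolding elastic_density_def
  by (intro continuous_intros) (auto simp: add_nonneg_eq_0_iff)

text \<open>For s = tan \<theta> one has sin(\<beta> - \<theta>) = cos \<theta> (sin \<beta> - s cos
  \<beta>) and cos \<theta> = (1 + s^2)^(-1/2). The left side is the derivative of
  \<open>- sqsin (\<beta> - arctan s)\<close>, so this identity makes the cross term of the
  calibration exact.\<close>

lemma sqrt_sin_diff_arctan:
  "sqrt (sin (\<beta> - arctan s)) * inverse (1 + s\<^sup>2) = elastic_density s * sqrt (sin \<beta> - s * cos \<beta>)"
proof -
  have p: "1 + s\<^sup>2 > 0" by (simp add: add_pos_nonneg)
  have "sin (\<beta> - arctan s) = (sin \<beta> - s * cos \<beta>) / sqrt (1 + s\<^sup>2)"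
    by (simp add: sin_diff sin_arctan cos_arctan diff_divide_distrib mult.commute)
  then have "sqrt (sin (\<beta> - arctan s)) * inverse (1 + s\<^sup>2)
     = sqrt (sin \<beta> - s * cos \<beta>) * (inverse (sqrt (sqrt (1 + s\<^sup>2))) * inverse (1 + s\<^sup>2))"
    by (simp add: real_sqrt_mult real_sqrt_inverse divide_inverse)
  also have "inverse (sqrt (sqrt (1 + s\<^sup>2))) * inverse (1 + s\<^sup>2) = elastic_density s"
  proof -
    have "sqrt (sqrt (1 + s\<^sup>2)) = (1 + s\<^sup>2) powr (1/4)"
      using p by (simp add: powr_half_sqrt[symmetric] powr_powr)
    then have "inverse (sqrt (sqrt (1 + s\<^sup>2))) * inverse (1 + s\<^sup>2) = (1 + s\<^sup>2) powr (-1/4) * (1 + s\<^sup>2) powr (-1)"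
      using p powr_minus[of "1 + s\<^sup>2" "1/4"] by (simp add: powr_minus)
    also have "\<dots> = elastic_density s"
      unfolding elastic_density_def powr_add[symmetric] by simp
    finally show ?thesis .
  qed
  finally show ?thesis by (simp add: mult.commute)
qed

text \<open>With \<open>e\<close> the curvature term and \<open>r\<close> the calibrating term, e^2
  + r^2 minus half of the defect (e - r)^2 is (e + r)^2 / 2. This is at least 2 e r, which is used
  up to \<open>x0\<close>, and at least 0, which is used after \<open>x0\<close>, where 2 e r has no
  definite sign. The other half of the defect stays in the estimate, for the discussion of
  equality.\<close>

lemma calibration_lower_bound:
  fixes p q :: "real \<Rightarrow> real"
  assumes q: "q absolutely_integrable_on {a..b}" and q2: "(\<lambda>x. (q x)\<^sup>2) integrable_on {a..b}"
    and p: "\<And>x. x \<in> {a..b} \<Longrightarrow> p x = p a + integral {a..x} q" and pa: "p a = 0"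
    and \<beta>: "0 < \<beta>" "\<beta> < pi/2" and le: "\<And>x. x \<in> {a..b} \<Longrightarrow> p x \<le> tan \<beta>"
    and x0: "x0 \<in> {a..b}" "p x0 = tan \<beta>"
  shows "(\<lambda>x. (q x * elastic_density (p x) - \<mu> * sqrt (sin \<beta> - p x * cos \<beta>))\<^sup>2) integrable_on {a..b}" (is ?t1)
    and "dual_energy \<mu> (b - a) (integral {a..b} p) \<beta>
      + integral {a..b} (\<lambda>x. (q x * elastic_density (p x) - \<mu> * sqrt (sin \<beta> - p x * cos \<beta>))\<^sup>2) / 2
      \<le> curvature_energy {a..b} p q" (is ?t2)
proof -
  have ab: "a \<le> b" using x0 by auto
  have pc: "continuous_on {a..b} p" by (rule abs_int_primitive_continuous[OF q p])
  have cb: "cos \<beta> > 0" using sin_cos_pos[OF \<beta>] by simp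
  define e where "e x = q x * elastic_density (p x)" for x
  define r where "r x = \<mu> * sqrt (sin \<beta> - p x * cos \<beta>)" for x
  have nn: "sin \<beta> - p x * cos \<beta> \<ge> 0" if "x \<in> {a..b}" for x
  proof -
    have "p x * cos \<beta> \<le> tan \<beta> * cos \<beta>" using le[OF that] cb by (intro mult_right_mono) auto
    also have "\<dots> = sin \<beta>" using cb by (simp add: tan_def)
    finally show ?thesis by simp
  qed
  have rc: "continuous_on {a..b} r" unfolding r_def by (intro continuous_intros pc)
  have ec: "continuous_on {a..b} (\<lambda>x. elastic_density (p x))" by (rule elastic_density_continuous[OF pc])
  have e2: "(\<lambda>x. (e x)\<^sup>2) integrable_on {a..b}"
  proof -
    have "(\<lambda>x. (q x)\<^sup>2) absolutely_integrable_on {a..b}"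
      by (rule nonnegative_absolutely_integrable_1[OF q2]) auto
    then have "(\<lambda>x. (elastic_density (p x))\<^sup>2 * (q x)\<^sup>2) absolutely_integrable_on {a..b}"
      by (rule absolutely_integrable_continuous_mult) (intro continuous_intros ec)
    then show ?thesis by (simp add: e_def power_mult_distrib mult.commute set_lebesgue_integral_eq_integral)
  qed
  have er: "(\<lambda>x. e x * r x) integrable_on {a..b}"
  proof -
    have "(\<lambda>x. (elastic_density (p x) * r x) * q x) absolutely_integrable_on {a..b}"
      by (intro absolutely_integrable_continuous_mult q continuous_intros ec rc)
    then show ?thesis by (simp add: e_def mult_ac set_lebesgue_integral_eq_integral)
  qed
  have r2: "((\<lambda>x. (r x)\<^sup>2) has_integral \<mu>\<^sup>2 * ((b - a) * sin \<beta> - integral {a..b} p * cos \<beta>)) {a..b}"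
  proof -
    have "((\<lambda>x. \<mu>\<^sup>2 * (sin \<beta> - p x * cos \<beta>)) has_integral \<mu>\<^sup>2 * ((b - a) * sin \<beta> - integral {a..b} p * cos \<beta>)) {a..b}"
      using has_integral_const_real[of "sin \<beta>" a b] ab
      by (intro has_integral_mult_right has_integral_diff has_integral_mult_left integrable_integral integrable_continuous_real pc) auto
    then show ?thesis
      by (rule has_integral_eq[rotated]) (use nn in \<open>auto simp: r_def power_mult_distrib\<close>)
  qed
  have er2: "(\<lambda>x. (e x - r x)\<^sup>2) integrable_on {a..b}"
  proof -
    have "(\<lambda>x. (e x)\<^sup>2 - 2 * (e x * r x) + (r x)\<^sup>2) integrable_on {a..b}"
      using r2 by (intro integrable_add integrable_diff integrable_on_mult_right e2 er) auto
    then show ?thesis by (simp add: power2_diff algebra_simps)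
  qed
  then show ?t1 by (simp add: e_def r_def)
  define F where "F x = (e x)\<^sup>2 - (e x - r x)\<^sup>2 / 2 + (r x)\<^sup>2" for x
  have F_eq: "F x = (e x + r x)\<^sup>2 / 2" for x
    by (simp add: F_def power2_eq_square field_simps)
  have F_ge: "F x \<ge> 2 * (e x * r x)" for x
    using zero_le_power2[of "e x - r x"] by (simp add: F_def power2_eq_square field_simps)
  have Fi: "(F has_integral curvature_energy {a..b} p q - integral {a..b} (\<lambda>x. (e x - r x)\<^sup>2) / 2
      + \<mu>\<^sup>2 * ((b - a) * sin \<beta> - integral {a..b} p * cos \<beta>)) {a..b}"
  proof -
    have "curvature_energy {a..b} p q = integral {a..b} (\<lambda>x. (e x)\<^sup>2)"
      by (simp add: curvature_energy_def e_def power_mult_distrib elastic_density_square)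
    then show ?thesis
      unfolding F_def using e2 er2 r2
      by (auto intro!: has_integral_add has_integral_diff has_integral_divide)
  qed
  \<comment> \<open>At \<open>x0\<close> the slope is tan \<beta>, so the primitive
    \<open>?Q (p x)\<close> runs from \<open>- sqsin \<beta>\<close> to 0.\<close>
  have J: "((\<lambda>x. 2 * (e x * r x)) has_integral 2 * (\<mu> * sqsin \<beta>)) {a..x0}"
  proof -
    let ?Q = "\<lambda>s. - sqsin (\<beta> - arctan s)" and ?Q' = "\<lambda>s. sqrt (sin (\<beta> - arctan s)) * inverse (1 + s\<^sup>2)"
    have sub: "{a..x0} \<subseteq> {a..b}" using x0 by auto
    have "((\<lambda>x. ?Q' (p x) * q x) has_integral ?Q (p x0) - ?Q (p a)) {a..x0}"
    proof (rule absolutely_continuous_chain_rule)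
      show "q absolutely_integrable_on {a..x0}" by (rule absolutely_integrable_on_subinterval[OF q sub])
      show "p x = p a + integral {a..x} q" if "x \<in> {a..x0}" for x using p that sub by blast
      show "(?Q has_real_derivative ?Q' s) (at s)" for s
      proof -
        have "\<beta> - arctan s > -4" using \<beta> arctan_ubound[of s] pi_less_4 by linarith
        then show ?thesis by (auto intro!: derivative_eq_intros sqsin_has_derivative')
      qed
      show "continuous_on UNIV ?Q'"
        by (intro continuous_intros) (auto simp: add_nonneg_eq_0_iff)
    qed (use x0 in auto)
    then have "((\<lambda>x. ?Q' (p x) * q x) has_integral sqsin \<beta>) {a..x0}"
      using \<beta> x0 pa by (simp add: arctan_tan)
    from has_integral_mult_right[OF has_integral_mult_right[OF this, of \<mu>], of 2]
    show ?thesis by (simp add: e_def r_def sqrt_sin_diff_arctan mult_ac)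
  qed
  have FI: "F integrable_on {a..b}" using Fi by blast
  have K: "integral {a..x0} F \<le> integral {a..b} F"
    using x0 by (intro integral_subset_le integrable_on_subinterval[OF FI] FI) (auto simp: F_eq)
  have L: "integral {a..x0} (\<lambda>x. 2 * (e x * r x)) \<le> integral {a..x0} F"
    using x0 by (intro integral_le integrable_on_subinterval[OF FI] F_ge
        integrable_on_mult_right integrable_on_subinterval[OF er]) auto
  have "2 * (\<mu> * sqsin \<beta>) \<le> integral {a..b} F"
    using integral_unique[OF J] K L by linarith
  with integral_unique[OF Fi] show ?t2
    by (simp add: dual_energy_def e_def r_def)
qed

text \<open>The calibration for the slope \<open>- v\<close>, with tan \<beta> its maximum on
  \<open>{a..1}\<close>, which is positive because \<open>u\<close> falls from \<open>a\<close> to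
  1. The multiplier stays free, since it may be chosen in terms of \<beta>.\<close>

lemma right_half_lower_bound:
  assumes r: "W22_rep u v w" and a: "-1 \<le> a" "a < 1" and va: "v a = 0" and h: "0 < u a - u 1"
  obtains \<beta> where "0 < \<beta>" "\<beta> < pi/2"
    "\<And>\<mu>. (\<lambda>x. (- w x * elastic_density (- v x) - \<mu> * sqrt (sin \<beta> + v x * cos \<beta>))\<^sup>2) integrable_on {a..1}"
    "\<And>\<mu>. dual_energy \<mu> (1 - a) (u a - u 1) \<beta>
      + integral {a..1} (\<lambda>x. (- w x * elastic_density (- v x) - \<mu> * sqrt (sin \<beta> + v x * cos \<beta>))\<^sup>2) / 2
      \<le> curvature_energy {a..1} v w"
proof -
  note f = W22_rep_facts[OF r] and R = r[unfolded W22_rep_def]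
  have sub: "{a..1} \<subseteq> {-1..1}" using a by auto
  have split: "g x = g a + integral {a..x} g'"
    if "g' integrable_on {-1..1}" "\<forall>x\<in>{-1..1}. g x = g (-1) + integral {-1..x} g'" "x \<in> {a..1}" for g g' :: "real \<Rightarrow> real" and x
  proof -
    have "integral {-1..a} g' + integral {a..x} g' = integral {-1..x} g'"
      using that a by (intro Henstock_Kurzweil_Integration.integral_combine integrable_on_subinterval[OF that(1)]) auto
    moreover have "g x = g (-1) + integral {-1..x} g'" "g a = g (-1) + integral {-1..a} g'"
      using that(2) that(3) a by (metis atLeastAtMost_iff sub subsetD, metis atLeastAtMost_iff less_imp_le)
    ultimately show ?thesis by linarith
  qed
  have vi: "v integrable_on {-1..1}" by (intro integrable_continuous_real f)
  have wi: "w integrable_on {-1..1}" using f(1) by (simp add: set_lebesgue_integral_eq_integral)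
  have vc: "continuous_on {a..1} v" by (rule continuous_on_subset[OF f(3) sub])
  have H: "integral {a..1} (\<lambda>x. - v x) = u a - u 1"
    using split[OF vi conjunct2[OF conjunct2[OF conjunct2[OF R]]], of 1] a by simp
  obtain x0 where x0: "x0 \<in> {a..1}" "\<And>x. x \<in> {a..1} \<Longrightarrow> - v x \<le> - v x0"
    using continuous_attains_sup[of "{a..1}" "\<lambda>x. - v x"] a continuous_on_minus[OF vc] by auto
  have "- v x0 > 0"
  proof (rule ccontr)
    assume "\<not> - v x0 > 0"
    then have "- v x \<le> 0" if "x \<in> {a..1}" for x using x0(2)[OF that] by linarith
    then have "integral {a..1} (\<lambda>x. - v x) \<le> integral {a..1} (\<lambda>x. 0)"
      by (intro integral_le integrable_continuous_real continuous_intros vc) auto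
    with H h show False by simp
  qed
  define \<beta> where "\<beta> = arctan (- v x0)"
  have \<beta>: "0 < \<beta>" "\<beta> < pi/2" and tb: "tan \<beta> = - v x0"
    using \<open>- v x0 > 0\<close> arctan_ubound by (auto simp: \<beta>_def tan_arctan simp del: arctan_minus)
  have 1: "(\<lambda>x. - w x) absolutely_integrable_on {a..1}"
    using absolutely_integrable_on_subinterval[OF f(1) sub] by (auto simp: absolutely_integrable_on_def intro: integrable_neg)
  have 2: "(\<lambda>x. (- w x)\<^sup>2) integrable_on {a..1}"
    using integrable_on_subinterval[OF f(2) sub] by simp
  have 3: "- v x = - v a + integral {a..x} (\<lambda>x. - w x)" if "x \<in> {a..1}" for x
    using split[OF wi conjunct1[OF conjunct2[OF conjunct2[OF R]]] that] by simp
  note cal = calibration_lower_bound[where p = "\<lambda>x. - v x" and q = "\<lambda>x. - w x", OF 1 2 3 _ \<beta> _ x0(1), unfolded tb H]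
  have ce: "curvature_energy {a..1} (\<lambda>x. - v x) (\<lambda>x. - w x) = curvature_energy {a..1} v w"
    by (simp add: curvature_energy_def)
  show ?thesis
    by (rule that[OF \<beta>]) (use cal x0(2) va ce in auto)
qed

lemma curvature_integrable:
  assumes "W22_rep u v w"
  shows "(\<lambda>x. (w x)\<^sup>2 * (1 + (v x)\<^sup>2) powr (-5/2)) integrable_on {-1..1}"
proof -
  note f = W22_rep_facts[OF assms]
  have "(\<lambda>x. (w x)\<^sup>2) absolutely_integrable_on {-1..1}"
    by (rule nonnegative_absolutely_integrable_1[OF f(2)]) auto
  moreover have "continuous_on {-1..1} (\<lambda>x. (elastic_density (v x))\<^sup>2)"
    by (intro continuous_intros elastic_density_continuous f)
  ultimately have "(\<lambda>x. (elastic_density (v x))\<^sup>2 * (w x)\<^sup>2) absolutely_integrable_on {-1..1}"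
    by (rule absolutely_integrable_continuous_mult)
  then show ?thesis
    by (simp add: elastic_density_square mult.commute set_lebesgue_integral_eq_integral)
qed

lemma Bfun_split:
  assumes r: "W22_rep u v w" and a: "-1 \<le> a" "a \<le> 1"
  shows "Bfun u = curvature_energy {a..1} v w + curvature_energy {-a..1} (\<lambda>x. - v (- x)) (\<lambda>x. w (- x))"
proof -
  let ?f = "\<lambda>x. (w x)\<^sup>2 * (1 + (v x)\<^sup>2) powr (-5/2)"
  have "integral {-1..a} ?f + integral {a..1} ?f = integral {-1..1} ?f"
    by (rule Henstock_Kurzweil_Integration.integral_combine[OF a curvature_integrable[OF r]])
  moreover have "integral {-a..1} (\<lambda>x. ?f (- x)) = integral {-1..a} ?f"
    using Henstock_Kurzweil_Integration.integral_reflect_real[of a "-1" ?f] by simp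
  ultimately show ?thesis
    by (simp add: Bfun_eq[OF r] curvature_energy_def)
qed

section \<open>The strict lower bound for high obstacles\<close>

lemma curvature_energy_gt:
  assumes r: "W22_rep u v w" and a: "-1 \<le> a" "a < 1" and va: "v a = 0" and h: "h_star \<le> u a - u 1"
  shows "curvature_energy {a..1} v w > c_star\<^sup>2 * (1 + a)"
proof -
  note c1 = c_star_ge_1
  let ?H = "u a - u 1"
  have "h_star > 0" using c1 by (simp add: h_star_def)
  with h have "0 < ?H" by linarith
  from right_half_lower_bound[OF r a va this] obtain \<beta> where \<beta>: "0 < \<beta>" "\<beta> < pi/2"
   and 1: "\<And>\<mu>. (\<lambda>x. (- w x * elastic_density (- v x) - \<mu> * sqrt (sin \<beta> + v x * cos \<beta>))\<^sup>2) integrable_on {a..1}"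
   and 2: "\<And>\<mu>. dual_energy \<mu> (1 - a) ?H \<beta>
      + integral {a..1} (\<lambda>x. (- w x * elastic_density (- v x) - \<mu> * sqrt (sin \<beta> + v x * cos \<beta>))\<^sup>2) / 2
      \<le> curvature_energy {a..1} v w" by blast
  define s k where "s = sin \<beta>" "k = cos \<beta> / sin \<beta>"
  have s: "s > 0" "k > 0" using sin_cos_pos[OF \<beta>] by (auto simp: s_k_def)
  \<comment> \<open>Makes \<open>\<mu>\<^sup>2 * s = c_star\<^sup>2\<close>, so that the length of
    the interval enters with a coefficient independent of \<beta>.\<close>
  define \<mu> where "\<mu> = c_star / sqrt s"
  have "0 \<le> integral {a..1} (\<lambda>x. (- w x * elastic_density (- v x) - \<mu> * sqrt (sin \<beta> + v x * cos \<beta>))\<^sup>2)"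
    by (rule integral_nonneg[OF 1]) auto
  with 2[of \<mu>] have ge: "dual_energy \<mu> (1 - a) ?H \<beta> \<le> curvature_energy {a..1} v w" by linarith
  have "dual_energy \<mu> (1 - a) ?H \<beta> = 2 * c_star * (sqsin \<beta> / sqrt s) - c_star\<^sup>2 * (1 - a) + c_star\<^sup>2 * ?H * k"
  proof -
    have "dual_energy \<mu> (1 - a) ?H \<beta> = 2 * \<mu> * sqsin \<beta> - \<mu>\<^sup>2 * (s * (1 - a) - ?H * (s * k))"
      using s by (simp add: dual_energy_def s_k_def mult.commute)
    also have "\<dots> = 2 * \<mu> * sqsin \<beta> - (\<mu>\<^sup>2 * s) * (1 - a - ?H * k)"
      by (simp add: algebra_simps)
    also have "\<mu>\<^sup>2 * s = c_star\<^sup>2" using s by (simp add: \<mu>_def power_divide)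
    finally show ?thesis by (simp add: \<mu>_def algebra_simps)
  qed
  moreover have "2 * c_star * (c_star - k) < 2 * c_star * (sqsin \<beta> / sqrt s)"
    using sqsin_cot_bound[OF \<beta>] c1 by (intro mult_strict_left_mono) (auto simp: s_k_def)
  \<comment> \<open>The threshold enters here: \<open>c_star * h_star = 2\<close> lets the height
    term absorb the cotangent from \<open>sqsin_cot_bound\<close>.\<close>
  moreover have "2 * c_star * k \<le> c_star\<^sup>2 * ?H * k"
  proof -
    have "2 * c_star = c_star\<^sup>2 * h_star" using c1 by (simp add: h_star_def power2_eq_square)
    also have "\<dots> \<le> c_star\<^sup>2 * ?H" using h by (intro mult_left_mono) auto
    finally show ?thesis using s by (intro mult_right_mono) auto
  qed
  ultimately show ?thesis using ge by (simp add: algebra_simps power2_eq_square)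
qed

text \<open>At a maximum point \<open>a\<close> the right part costs more than
  \<open>c_star\<^sup>2 * (1 + a)\<close> and the left part more than
  \<open>c_star\<^sup>2 * (1 - a)\<close>. The position of \<open>a\<close> cancels in the sum, so
  asymmetric functions are covered.\<close>

lemma Bfun_gt_if_high_obstacle:
  assumes u: "u \<in> X_psi \<psi>" and h: "\<psi> 0 \<ge> h_star"
  shows "Bfun u > 2 * c_star\<^sup>2"
proof -
  have "W22 u" and u1: "u (-1) = 0" "u 1 = 0" and u0: "u 0 \<ge> \<psi> 0"
    using u by (auto simp: X_psi_def)
  then obtain v w where r: "W22_rep u v w" using W22_iff by blast
  note f = W22_rep_facts[OF r]
  have hs: "h_star > 0" using c_star_ge_1 by (simp add: h_star_def)
  obtain a where a: "a \<in> {-1..1}" "\<And>x. x \<in> {-1..1} \<Longrightarrow> u x \<le> u a"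
    using continuous_attains_sup[of "{-1..1}" u] f(4) by auto
  have ua: "h_star \<le> u a" using a(2)[of 0] u0 h by auto
  with hs u1 have "a \<noteq> -1" "a \<noteq> 1" by auto
  with a have a': "-1 < a" "a < 1" by auto
  have "(u has_real_derivative v a) (at a)"
    using f(5)[OF a(1)] a' at_within_interior[of a "{-1..1}"] by simp
  then have va: "v a = 0"
  proof (rule DERIV_local_max[of _ _ _ "min (1 - a) (a + 1)"])
    show "\<forall>y. \<bar>a - y\<bar> < min (1 - a) (a + 1) \<longrightarrow> u y \<le> u a"
      by (intro allI impI a(2)) auto
  qed (use a' in auto)
  have "curvature_energy {a..1} v w > c_star\<^sup>2 * (1 + a)"
    by (rule curvature_energy_gt[OF r]) (use a' va ua u1 in auto)
  moreover have "curvature_energy {-a..1} (\<lambda>x. - v (- x)) (\<lambda>x. w (- x)) > c_star\<^sup>2 * (1 + - a)"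
    by (rule curvature_energy_gt[OF W22_rep_reflect[OF r]]) (use a' va ua u1 in auto)
  ultimately show ?thesis
    using Bfun_split[OF r, of a] a' by (simp add: algebra_simps)
qed

lemma even_imp_derivative_0:
  assumes r: "W22_rep u v w" and even: "\<And>x. x \<in> {-1..1} \<Longrightarrow> u x = u (- x)"
  shows "v 0 = 0"
proof -
  have d: "(u has_real_derivative v 0) (at 0)"
    using W22_rep_facts(5)[OF r, of 0] at_within_interior[of 0 "{-1..1::real}"] by simp
  have "((\<lambda>x. u (- x)) has_real_derivative v 0 * (-1)) (at 0)"
    by (rule DERIV_chain2[of u]) (use d in \<open>auto intro!: derivative_eq_intros\<close>)
  then have "(u has_real_derivative v 0 * (-1)) (at 0)"
    by (rule has_field_derivative_transform_within_open[where S = "{-1<..<1}"]) (auto intro: even[symmetric])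
  from DERIV_unique[OF d this] show ?thesis by simp
qed

section \<open>The case of equality\<close>

text \<open>An antiderivative of \<open>elastic_density\<close>: the calibration primitive for the
  angle pi/2, where sin \<beta> - s cos \<beta> is 1.\<close>

definition elastic_primitive :: "real \<Rightarrow> real" where
  "elastic_primitive s = - sqsin (pi/2 - arctan s)"

lemma elastic_primitive_has_derivative:
  "(elastic_primitive has_real_derivative elastic_density s) (at s)"
proof -
  have "pi/2 - arctan s > -4" using arctan_ubound[of s] pi_less_4 by linarith
  then have "(elastic_primitive has_real_derivative sqrt (sin (pi/2 - arctan s)) * inverse (1 + s\<^sup>2)) (at s)"
    unfolding elastic_primitive_def[abs_def] by (auto intro!: derivative_eq_intros sqsin_has_derivative')
  then show ?thesis by (simp only: sqrt_sin_diff_arctan) simp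
qed

lemma elastic_primitive_strict_mono: "strict_mono elastic_primitive"
proof (rule strict_monoI)
  fix x y :: real assume "x < y"
  then show "elastic_primitive x < elastic_primitive y"
    by (rule DERIV_pos_imp_increasing) (blast intro: elastic_primitive_has_derivative elastic_density_pos)
qed

text \<open>A vanishing defect gives the first order equation almost everywhere. By the chain rule
  \<open>elastic_primitive (p x)\<close> is then an integral of the continuous function
  \<open>r\<close>, so the equation holds at every point.\<close>

lemma calibrated_primitive_derivative:
  assumes q: "q absolutely_integrable_on {a..b}"
    and p: "\<And>x. x \<in> {a..b} \<Longrightarrow> p x = p a + integral {a..x} q"
    and r: "continuous_on {a..b} r"
    and i: "(\<lambda>x. (q x * elastic_density (p x) - r x)\<^sup>2) integrable_on {a..b}"
    and zero: "integral {a..b} (\<lambda>x. (q x * elastic_density (p x) - r x)\<^sup>2) = 0"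
    and x: "x \<in> {a..b}"
  shows "((\<lambda>x. elastic_primitive (p x)) has_real_derivative r x) (at x within {a..b})"
proof -
  let ?f = "\<lambda>x. (q x * elastic_density (p x) - r x)\<^sup>2"
  have "?f absolutely_integrable_on {a..b}"
    by (rule nonnegative_absolutely_integrable_1[OF i]) auto
  from negligible_if_integral_abs_eq_0[OF this] zero
  have N: "negligible {x \<in> {a..b}. q x * elastic_density (p x) \<noteq> r x}" by simp
  have eq: "elastic_primitive (p y) = elastic_primitive (p a) + integral {a..y} r" if y: "y \<in> {a..b}" for y
  proof -
    have sub: "{a..y} \<subseteq> {a..b}" using y by auto
    have "((\<lambda>x. elastic_density (p x) * q x) has_integral elastic_primitive (p y) - elastic_primitive (p a)) {a..y}"
    proof (rule absolutely_continuous_chain_rule)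
      show "q absolutely_integrable_on {a..y}" by (rule absolutely_integrable_on_subinterval[OF q sub])
      show "p x = p a + integral {a..x} q" if "x \<in> {a..y}" for x using p that sub by blast
      show "continuous_on UNIV elastic_density"
        using elastic_density_continuous[OF continuous_on_id] by simp
      show "(elastic_primitive has_real_derivative elastic_density s) (at s)" for s
        by (rule elastic_primitive_has_derivative)
    qed (use y in auto)
    moreover have "integral {a..y} (\<lambda>x. elastic_density (p x) * q x) = integral {a..y} r"
      by (rule integral_spike[OF N]) (use sub in \<open>auto simp: mult.commute\<close>)
    ultimately show ?thesis by (simp add: integral_unique)
  qed
  have "((\<lambda>x. elastic_primitive (p a) + integral {a..x} r) has_real_derivative 0 + r x) (at x within {a..b})"
    by (intro DERIV_add integral_has_real_derivative r x) auto
  then have "((\<lambda>x. elastic_primitive (p a) + integral {a..x} r) has_real_derivative r x) (at x within {a..b})"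
    by simp
  then show ?thesis
    by (rule has_field_derivative_transform_within[OF _ zero_less_one x]) (rule eq[symmetric])
qed

text \<open>The right-hand side decreases in \<open>p\<close>, so the squared distance of two solutions cannot grow.\<close>

lemma calibrated_unique:
  assumes d1: "\<And>x. x \<in> {a..b} \<Longrightarrow> ((\<lambda>x. elastic_primitive (p1 x)) has_real_derivative \<mu> * sqrt (\<sigma> - p1 x * k)) (at x within {a..b})"
    and d2: "\<And>x. x \<in> {a..b} \<Longrightarrow> ((\<lambda>x. elastic_primitive (p2 x)) has_real_derivative \<mu> * sqrt (\<sigma> - p2 x * k)) (at x within {a..b})"
    and init: "p1 a = p2 a" and mu: "\<mu> \<ge> 0" and k: "k \<ge> 0" and x: "x \<in> {a..b}"
  shows "p1 x = p2 x"
proof -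
  let ?z = "\<lambda>x. elastic_primitive (p1 x) - elastic_primitive (p2 x)"
  let ?r = "\<lambda>x. \<mu> * sqrt (\<sigma> - p1 x * k) - \<mu> * sqrt (\<sigma> - p2 x * k)"
  have z: "(?z has_real_derivative ?r x) (at x within {a..b})" if "x \<in> {a..b}" for x
    by (intro DERIV_diff d1 d2 that)
  have mono: "elastic_primitive s \<le> elastic_primitive t" if "s \<le> t" for s t
    using that by (simp add: strict_mono_less_eq[OF elastic_primitive_strict_mono])
  have sgn: "?z x * ?r x \<le> 0" for x
  proof (cases "p1 x \<le> p2 x")
    case True
    have "?z x \<le> 0" using mono[OF True] by simp
    moreover have "?r x \<ge> 0" using True mu k by (simp add: mult_left_mono mult_right_mono)
    ultimately show ?thesis by (rule mult_nonpos_nonneg)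
  next
    case False
    then have le: "p2 x \<le> p1 x" by simp
    have "?z x \<ge> 0" using mono[OF le] by simp
    moreover have "?r x \<le> 0" using le mu k by (simp add: mult_left_mono mult_right_mono)
    ultimately show ?thesis by (rule mult_nonneg_nonpos)
  qed
  have "(?z x)\<^sup>2 \<le> (?z a)\<^sup>2"
  proof (rule DERIV_nonpos_imp_decreasing_open[of a x "\<lambda>x. (?z x)\<^sup>2"])
    show "a \<le> x" using x by simp
    fix t assume t: "a < t" "t < x"
    have "(?z has_real_derivative ?r t) (at t)"
      using z[of t] t x at_within_interior[of t "{a..b}"] by simp
    then have "((\<lambda>x. (?z x)\<^sup>2) has_real_derivative 2 * (?z t * ?r t)) (at t)"
      by (rule DERIV_cong[OF DERIV_power]) simp
    moreover have "2 * (?z t * ?r t) \<le> 0" using sgn[of t] by linarith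
    ultimately show "\<exists>y. ((\<lambda>x. (?z x)\<^sup>2) has_real_derivative y) (at t) \<and> y \<le> 0"
      by blast
  next
    have "continuous_on {a..b} ?z" by (rule DERIV_continuous_on[OF z])
    then show "continuous_on {a..x} (\<lambda>x. (?z x)\<^sup>2)"
      using x by (intro continuous_on_power) (auto intro: continuous_on_subset)
  qed
  then have "?z x = 0" using init by simp
  then show ?thesis by (simp add: strict_mono_eq[OF elastic_primitive_strict_mono])
qed

text \<open>The multiplier belongs to \<alpha>, while the steepest angle \<beta> of \<open>u\<close>
  is unknown. A height above \<open>h\<close> only raises the bound, as cos \<beta> > 0, and among
  all \<beta> the bound is least at \<alpha>. Equality forces \<beta> = \<alpha>, by strictness of
  that minimum, and a vanishing defect.\<close>

lemma half_energy_lower_bound: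
  assumes r: "W22_rep u v w" and v0: "v 0 = 0" and u1: "u 1 = 0" and u0: "h \<le> u 0" and h: "0 < h" "h \<le> 2"
    and \<alpha>: "0 < \<alpha>" "\<alpha> < pi/2" and mu: "\<mu> = 2 * sqrt (sin \<alpha>) / (cos \<alpha> + h * sin \<alpha>)"
  shows "dual_energy \<mu> 1 h \<alpha> \<le> curvature_energy {0..1} v w" (is ?t1)
    and "curvature_energy {0..1} v w = dual_energy \<mu> 1 h \<alpha> \<Longrightarrow> x \<in> {0..1} \<Longrightarrow>
      ((\<lambda>x. elastic_primitive (- v x)) has_real_derivative \<mu> * sqrt (sin \<alpha> - (- v x) * cos \<alpha>)) (at x within {0..1})"
proof -
  have "0 < u 0 - u 1" using u0 u1 h by simp
  with right_half_lower_bound[OF r, of 0] v0 obtain \<beta> where \<beta>: "0 < \<beta>" "\<beta> < pi/2"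
   and 1: "\<And>\<mu>. (\<lambda>x. (- w x * elastic_density (- v x) - \<mu> * sqrt (sin \<beta> + v x * cos \<beta>))\<^sup>2) integrable_on {0..1}"
   and 2: "\<And>\<mu>. dual_energy \<mu> (1 - 0) (u 0 - u 1) \<beta>
      + integral {0..1} (\<lambda>x. (- w x * elastic_density (- v x) - \<mu> * sqrt (sin \<beta> + v x * cos \<beta>))\<^sup>2) / 2
      \<le> curvature_energy {0..1} v w" by auto
  let ?J = "integral {0..1} (\<lambda>x. (- w x * elastic_density (- v x) - \<mu> * sqrt (sin \<beta> + v x * cos \<beta>))\<^sup>2)"
  have J: "0 \<le> ?J" by (rule integral_nonneg[OF 1]) auto
  have "\<mu>\<^sup>2 * (h * cos \<beta>) \<le> \<mu>\<^sup>2 * (u 0 * cos \<beta>)"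
    using u0 sin_cos_pos[OF \<beta>] by (intro mult_left_mono mult_right_mono) auto
  then have "dual_energy \<mu> 1 h \<beta> \<le> dual_energy \<mu> (1 - 0) (u 0 - u 1) \<beta>"
    by (simp add: dual_energy_def u1 algebra_simps)
  with 2[of \<mu>] have le: "dual_energy \<mu> 1 h \<beta> + ?J / 2 \<le> curvature_energy {0..1} v w" by linarith
  have min: "\<beta> \<noteq> \<alpha> \<Longrightarrow> dual_energy \<mu> 1 h \<alpha> < dual_energy \<mu> 1 h \<beta>"
    by (rule dual_energy_strict_min) (use h \<alpha> \<beta> mu in auto)
  then show ?t1 using le J by (cases "\<beta> = \<alpha>") auto
  assume eq: "curvature_energy {0..1} v w = dual_energy \<mu> 1 h \<alpha>" and x: "x \<in> {0..1}"
  have ba: "\<beta> = \<alpha>" and J0: "?J = 0" using min le J eq by (cases "\<beta> = \<alpha>", auto)+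
  note f = W22_rep_facts[OF r] and R = r[unfolded W22_rep_def]
  have sub: "{0..1} \<subseteq> {-1..1::real}" by auto
  show "((\<lambda>x. elastic_primitive (- v x)) has_real_derivative \<mu> * sqrt (sin \<alpha> - (- v x) * cos \<alpha>)) (at x within {0..1})"
  proof (rule calibrated_primitive_derivative[where q = "\<lambda>x. - w x"])
    show "(\<lambda>x. - w x) absolutely_integrable_on {0..1}"
      using absolutely_integrable_on_subinterval[OF f(1) sub]
      by (auto simp: absolutely_integrable_on_def intro: integrable_neg)
    show "continuous_on {0..1} (\<lambda>x. \<mu> * sqrt (sin \<alpha> - - v x * cos \<alpha>))"
      by (intro continuous_intros continuous_on_subset[OF f(3) sub])
    fix x :: real assume x: "x \<in> {0..1}"
    have wi: "w integrable_on {-1..1}" using f(1) by (simp add: set_lebesgue_integral_eq_integral)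
    have "integral {-1..0} w + integral {0..x} w = integral {-1..x} w"
      using x by (intro Henstock_Kurzweil_Integration.integral_combine integrable_on_subinterval[OF wi]) auto
    moreover note bspec[OF conjunct1[OF conjunct2[OF conjunct2[OF R]]], of 0]
     bspec[OF conjunct1[OF conjunct2[OF conjunct2[OF R]]], of x]
    ultimately have "v x = v 0 + integral {0..x} w" using x by auto
    then show "- v x = - v 0 + integral {0..x} (\<lambda>x. - w x)" by simp
  next
    have e: "sin \<alpha> - - v x * cos \<alpha> = sin \<alpha> + v x * cos \<alpha>" for x by simp
    show "(\<lambda>x. (- w x * elastic_density (- v x) - \<mu> * sqrt (sin \<alpha> - - v x * cos \<alpha>))\<^sup>2) integrable_on {0..1}"
      unfolding e using 1[of \<mu>] unfolding ba .
    show "integral {0..1} (\<lambda>x. (- w x * elastic_density (- v x) - \<mu> * sqrt (sin \<alpha> - - v x * cos \<alpha>))\<^sup>2) = 0"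
      unfolding e using J0 unfolding ba .
  qed (use x in auto)
qed

section \<open>Rectangular elasticae\<close>

text \<open>A rectangular elastica has squared curvature proportional to the sine of the angle \<open>\<theta>\<close> between
  its tangent and its tangent at the inflection point. Here it is rotated so that the inflection point
  is the right end point, where the slope is \<open>- tan \<alpha>\<close>, and the tangent at the left end point is horizontal;
  \<open>abscissa \<theta>\<close> is the normalized horizontal distance from the inflection point.\<close>

locale elastica =
  fixes \<alpha> :: real
  assumes \<alpha>: "0 < \<alpha>" "\<alpha> < pi/2"
begin

text \<open>The extents before normalization: \<open>width\<close> and \<open>height\<close> are the
  integrals of cos(\<alpha> - \<theta>) / sqrt(sin \<theta>) and sin(\<alpha> - \<theta>) / sqrt(sin
  \<theta>) over \<theta> from 0 to \<alpha>, in closed form.\<close>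

definition width :: real where "width = 2 * cos \<alpha> * sqrt (sin \<alpha>) + sin \<alpha> * sqsin \<alpha>"
definition height :: real where "height = 2 * sin \<alpha> * sqrt (sin \<alpha>) - cos \<alpha> * sqsin \<alpha>"
definition abscissa :: "real \<Rightarrow> real" where
  "abscissa \<theta> = (2 * cos \<alpha> * sqrt (sin \<theta>) + sin \<alpha> * sqsin \<theta>) / width"
definition angle :: "real \<Rightarrow> real" where "angle = inv_into {0..\<alpha>} abscissa"

lemma sc_pos: "sin \<alpha> > 0" "cos \<alpha> > 0"
  using sin_cos_pos[OF \<alpha>] by auto

lemma sqsin_alpha_pos: "sqsin \<alpha> > 0"
  using \<alpha> by (intro sqsin_pos) auto

lemma width_pos: "width > 0"
  unfolding width_def using sc_pos sqsin_alpha_pos by (intro add_pos_pos mult_pos_pos) auto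

text \<open>The component, normal to the tangent at the inflection point, of the displacement
  between the end points. It serves to identify the energy of the elastica with the dual
  bound.\<close>

lemma width_height: "width * sin \<alpha> - height * cos \<alpha> = sqsin \<alpha>"
proof -
  have "(2 * c * r + s * y) * s - (2 * s * r - c * y) * c = y * (s\<^sup>2 + c\<^sup>2)" for c r s y :: real
    by algebra
  from this[of "cos \<alpha>" "sqrt (sin \<alpha>)" "sin \<alpha>" "sqsin \<alpha>"]
  have "width * sin \<alpha> - height * cos \<alpha> = sqsin \<alpha> * ((sin \<alpha>)\<^sup>2 + (cos \<alpha>)\<^sup>2)"
    unfolding width_def height_def .
  then show ?thesis by simp
qed

lemma abscissa_0: "abscissa 0 = 0" and abscissa_alpha: "abscissa \<alpha> = 1"
  using width_pos by (auto simp: abscissa_def width_def)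

lemma abscissa_has_derivative:
  assumes "0 < \<theta>" "\<theta> \<le> \<alpha>"
  shows "(abscissa has_real_derivative cos (\<alpha> - \<theta>) / (sqrt (sin \<theta>) * width)) (at \<theta>)"
proof -
  have s: "sin \<theta> > 0" using assms \<alpha> by (intro sin_gt_zero) auto
  have "((\<lambda>t. sqrt (sin t)) has_real_derivative cos \<theta> / (2 * sqrt (sin \<theta>))) (at \<theta>)"
    using s by (auto intro!: derivative_eq_intros simp: field_simps)
  then have "(abscissa has_real_derivative
     (2 * cos \<alpha> * (cos \<theta> / (2 * sqrt (sin \<theta>))) + sin \<alpha> * sqrt (sin \<theta>)) / width) (at \<theta>)"
    unfolding abscissa_def[abs_def] using assms
    by (intro DERIV_cdivide DERIV_add DERIV_cmult sqsin_has_derivative) auto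
  moreover have "2 * cos \<alpha> * (cos \<theta> / (2 * sqrt (sin \<theta>))) + sin \<alpha> * sqrt (sin \<theta>) = cos (\<alpha> - \<theta>) / sqrt (sin \<theta>)"
  proof -
    have *: "2 * c * (d / (2 * r)) + e * r = (c * d + e * (r * r)) / r" if "r > 0" for c d e r :: real
      using that by (simp add: field_simps)
    have "sqrt (sin \<theta>) > 0" using s by simp
    from *[OF this, of "cos \<alpha>" "cos \<theta>" "sin \<alpha>"] show ?thesis
      using s by (simp add: cos_diff)
  qed
  ultimately show ?thesis by simp
qed

lemma cos_diff_pos: "0 \<le> \<theta> \<Longrightarrow> \<theta> \<le> \<alpha> \<Longrightarrow> cos (\<alpha> - \<theta>) > 0"
  using \<alpha> by (intro cos_gt_zero_pi) auto

lemma abscissa_continuous: "continuous_on {0..\<alpha>} abscissa"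
  unfolding abscissa_def[abs_def] using width_pos
  by (intro continuous_intros continuous_on_subset[OF sqsin_continuous]) auto

lemma abscissa_strict_mono:
  assumes "0 \<le> x" "x < y" "y \<le> \<alpha>"
  shows "abscissa x < abscissa y"
proof (rule DERIV_pos_imp_increasing_open[OF assms(2)])
  fix t assume t: "x < t" "t < y"
  have "sin t > 0" using assms t \<alpha> by (intro sin_gt_zero) auto
  then have "cos (\<alpha> - t) / (sqrt (sin t) * width) > 0"
    using width_pos cos_diff_pos[of t] t assms by auto
  with abscissa_has_derivative[of t] t assms
  show "\<exists>d. (abscissa has_real_derivative d) (at t) \<and> 0 < d" by auto
next
  show "continuous_on {x..y} abscissa" by (rule continuous_on_subset[OF abscissa_continuous]) (use assms in auto)
qed

lemma abscissa_inj: "inj_on abscissa {0..\<alpha>}"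
proof (rule inj_onI)
  fix x y assume *: "x \<in> {0..\<alpha>}" "y \<in> {0..\<alpha>}" "abscissa x = abscissa y"
  show "x = y"
    using abscissa_strict_mono[of x y] abscissa_strict_mono[of y x] * by (cases x y rule: linorder_cases) auto
qed

lemma abscissa_image: "abscissa ` {0..\<alpha>} = {0..1}"
proof (intro equalityI subsetI)
  fix y assume "y \<in> abscissa ` {0..\<alpha>}"
  then obtain x where x: "x \<in> {0..\<alpha>}" "y = abscissa x" by blast
  then show "y \<in> {0..1}"
    using abscissa_strict_mono[of 0 x] abscissa_strict_mono[of x \<alpha>] abscissa_0 abscissa_alpha
    by (cases "x = 0"; cases "x = \<alpha>") auto
next
  fix y :: real assume "y \<in> {0..1}"
  then have "\<exists>x\<ge>0. x \<le> \<alpha> \<and> abscissa x = y"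
    using \<alpha> by (intro IVT' abscissa_continuous) (auto simp: abscissa_0 abscissa_alpha)
  then show "y \<in> abscissa ` {0..\<alpha>}" by auto
qed

lemma angle_range: "y \<in> {0..1} \<Longrightarrow> angle y \<in> {0..\<alpha>}"
  unfolding angle_def by (rule inv_into_into) (simp add: abscissa_image)

lemma abscissa_angle: "y \<in> {0..1} \<Longrightarrow> abscissa (angle y) = y"
  unfolding angle_def by (rule f_inv_into_f) (simp add: abscissa_image)

lemma angle_abscissa: "x \<in> {0..\<alpha>} \<Longrightarrow> angle (abscissa x) = x"
  unfolding angle_def by (rule inv_into_f_f[OF abscissa_inj])

lemma angle_0: "angle 0 = 0" and angle_1: "angle 1 = \<alpha>"
  using angle_abscissa[of 0] angle_abscissa[of \<alpha>] \<alpha> by (auto simp: abscissa_0 abscissa_alpha)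

lemma angle_continuous: "continuous_on {0..1} angle"
  unfolding abscissa_image[symmetric]
  by (rule continuous_on_inv[OF abscissa_continuous]) (use angle_abscissa in auto)

lemma angle_mono:
  assumes "0 \<le> x" "x \<le> y" "y \<le> 1"
  shows "angle x \<le> angle y"
proof (rule ccontr)
  have xy: "x \<in> {0..1}" "y \<in> {0..1}" using assms by auto
  assume "\<not> angle x \<le> angle y"
  then have "abscissa (angle y) < abscissa (angle x)"
    using angle_range[OF xy(1)] angle_range[OF xy(2)] by (intro abscissa_strict_mono) simp_all
  then show False using assms by (simp add: abscissa_angle xy)
qed

lemma angle_pos:
  assumes "0 < y" "y \<le> 1"
  shows "0 < angle y"
proof -
  have y: "y \<in> {0..1}" using assms by simp
  have "angle y \<noteq> 0" using abscissa_angle[OF y] abscissa_0 assms by auto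
  with angle_range[OF y] show ?thesis by simp
qed

lemma angle_has_derivative:
  assumes "0 < y" "y < 1"
  shows "(angle has_real_derivative width * sqrt (sin (angle y)) / cos (\<alpha> - angle y)) (at y)"
proof -
  have y: "y \<in> {0..1}" using assms by simp
  have r: "0 < angle y" "angle y \<le> \<alpha>" using angle_pos[of y] angle_range[OF y] assms by simp_all
  have s: "sin (angle y) > 0" using r \<alpha> by (intro sin_gt_zero) auto
  have c: "cos (\<alpha> - angle y) > 0" using r by (intro cos_diff_pos) auto
  have "isCont angle y"
    using continuous_on_interior[OF angle_continuous, of y] assms by simp
  then have "(angle has_real_derivative inverse (cos (\<alpha> - angle y) / (sqrt (sin (angle y)) * width))) (at y)"
    using s c width_pos assms
    by (intro DERIV_inverse_function[where f = abscissa and a = 0 and b = 1] abscissa_has_derivative r) (simp_all add: abscissa_angle)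
  then show ?thesis by (simp add: mult.commute)
qed

end

text \<open>The elastica is scaled to width \<open>l\<close> and continued by its tangent line on \<open>{l..1}\<close>.\<close>

locale elastica_profile = elastica +
  fixes l :: real
  assumes l: "0 < l" "l \<le> 1"
begin

text \<open>The argument 1 - x / l turns the distance from the inflection point into one from the
  left end; clamping it at 0 freezes the angle beyond \<open>l\<close>, which produces the straight
  continuation.\<close>

definition ang :: "real \<Rightarrow> real" where "ang x = angle (max 0 (1 - x / l))"
definition slope :: "real \<Rightarrow> real" where "slope x = tan (\<alpha> - ang x)"
text \<open>It vanishes from \<open>l\<close> on, since the curvature is 0 at the inflection point;
  hence the continued profile has a continuous second derivative.\<close>

definition slope' :: "real \<Rightarrow> real" where
  "slope' x = width * sqrt (sin (ang x)) / (l * cos (\<alpha> - ang x) ^ 3)"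

lemma clamp_range: "0 \<le> x \<Longrightarrow> max 0 (1 - x / l) \<in> {0..1}"
  using l by (auto simp: max_def)

lemma ang_range: "0 \<le> x \<Longrightarrow> 0 \<le> ang x \<and> ang x \<le> \<alpha>"
  unfolding ang_def using angle_range[OF clamp_range] by auto

lemma ang_0: "ang 0 = \<alpha>"
  by (simp add: ang_def angle_1)

lemma ang_ge: "l \<le> x \<Longrightarrow> ang x = 0"
  using l by (simp add: ang_def angle_0 max_def field_simps)

lemma ang_antimono:
  assumes "0 \<le> x" "x \<le> y"
  shows "ang y \<le> ang x"
proof -
  have "x / l \<le> y / l" using assms l by (intro divide_right_mono) auto
  then show ?thesis
    unfolding ang_def using clamp_range[OF assms(1)] by (intro angle_mono) auto
qed

lemma ang_continuous: "continuous_on {0..1} ang"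
  unfolding ang_def[abs_def]
  by (rule continuous_on_compose2[OF angle_continuous])
    (use l in \<open>auto intro!: continuous_intros clamp_range\<close>)

lemma cos_ang_pos: "0 \<le> x \<Longrightarrow> cos (\<alpha> - ang x) > 0"
  using ang_range[of x] by (intro cos_diff_pos) auto

lemma ang_has_derivative:
  assumes x: "0 < x" "x \<noteq> l"
  shows "(ang has_real_derivative - (width * sqrt (sin (ang x)) / (l * cos (\<alpha> - ang x)))) (at x)"
proof (cases "x < l")
  case True
  have y: "0 < 1 - x / l" "1 - x / l < 1" using True x l by (auto simp: field_simps)
  have e: "ang t = angle (1 - t / l)" if "t < l" for t
    using that l by (simp add: ang_def max_def field_simps)
  have "((\<lambda>t. angle (1 - t / l)) has_real_derivative
      width * sqrt (sin (angle (1 - x / l))) / cos (\<alpha> - angle (1 - x / l)) * (- (1 / l))) (at x)"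
    by (rule DERIV_chain2[where f = angle and g = "\<lambda>t. 1 - t / l", OF angle_has_derivative[OF y]]) (use l in \<open>auto intro!: derivative_eq_intros\<close>)
  then have "((\<lambda>t. angle (1 - t / l)) has_real_derivative
      - (width * sqrt (sin (ang x)) / (l * cos (\<alpha> - ang x)))) (at x)"
    by (simp add: e[OF True] mult.commute)
  then show ?thesis
    by (rule has_field_derivative_transform_within_open[where S = "{..<l}"]) (use True e in auto)
next
  case False
  with x have xl: "l < x" by simp
  have "((\<lambda>_. 0) has_real_derivative 0) (at x)" by simp
  then have "(ang has_real_derivative 0) (at x)"
    by (rule has_field_derivative_transform_within_open[where S = "{l<..}"]) (use xl ang_ge in auto)
  then show ?thesis using ang_ge[of x] xl by simp
qed

lemma slope_has_derivative:
  assumes x: "0 < x" "x \<noteq> l"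
  shows "(slope has_real_derivative slope' x) (at x)"
proof -
  have c: "cos (\<alpha> - ang x) > 0" using x by (intro cos_ang_pos) auto
  have "((\<lambda>t. tan (\<alpha> - ang t)) has_real_derivative
     inverse ((cos (\<alpha> - ang x))\<^sup>2) * (0 - - (width * sqrt (sin (ang x)) / (l * cos (\<alpha> - ang x))))) (at x)"
    by (rule DERIV_chain2[OF DERIV_tan DERIV_diff[OF DERIV_const ang_has_derivative[OF x]]]) (use c in simp)
  moreover have "inverse (k\<^sup>2) * (0 - - (y / (l * k))) = y / (l * k ^ 3)" for k y :: real
    by (simp add: field_simps power2_eq_square power3_eq_cube)
  ultimately show ?thesis
    unfolding slope_def[abs_def] slope'_def by simp
qed

lemma slope_continuous: "continuous_on {0..1} slope"
  unfolding slope_def[abs_def]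
  by (intro continuous_intros ang_continuous) (use cos_ang_pos in fastforce)

lemma slope'_continuous: "continuous_on {0..1} slope'"
  unfolding slope'_def[abs_def]
  by (intro continuous_intros ang_continuous) (use l cos_ang_pos in fastforce)

lemma slope_0: "slope 0 = 0"
  by (simp add: slope_def ang_0)

lemma slope_ge: "l \<le> x \<Longrightarrow> slope x = tan \<alpha>"
  by (simp add: slope_def ang_ge)

lemma slope_mono:
  assumes "0 \<le> x" "x \<le> y"
  shows "slope x \<le> slope y"
  unfolding slope_def
proof (rule tan_mono_le)
  show "- (pi/2) < \<alpha> - ang x" using ang_range[of x] assms pi_gt_zero by linarith
  show "\<alpha> - ang x \<le> \<alpha> - ang y" using ang_antimono[OF assms] by simp
  show "\<alpha> - ang y < pi / 2" using ang_range[of y] assms \<alpha> by simp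
qed

lemma slope_nonneg: "0 \<le> x \<Longrightarrow> 0 \<le> slope x"
  using slope_mono[of 0 x] slope_0 by simp

text \<open>The calibration equation in squared form, with multiplier \<open>width / l\<close>: both
  sides equal (width / l)^2 sin(ang x) / cos(\<alpha> - ang x).\<close>

lemma slope_energy_density:
  assumes "0 \<le> x"
  shows "(slope' x)\<^sup>2 * (1 + (slope x)\<^sup>2) powr (-5/2) = (width / l)\<^sup>2 * (sin \<alpha> - slope x * cos \<alpha>)"
proof -
  define k where "k = cos (\<alpha> - ang x)"
  have k: "k > 0" using cos_ang_pos[OF assms] by (simp add: k_def)
  have s: "sin (ang x) \<ge> 0" using ang_range[OF assms] \<alpha> by (intro sin_ge_zero) auto
  have "1 + (slope x)\<^sup>2 = inverse (k\<^sup>2)"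
    using k tan_sec[of "\<alpha> - ang x"] by (simp add: slope_def k_def power_inverse)
  also have "\<dots> = k powr (-2)"
    using k by (simp add: powr_minus)
  finally have "(1 + (slope x)\<^sup>2) powr (-5/2) = k ^ 5"
    using k by (simp add: powr_powr)
  then have "(slope' x)\<^sup>2 * (1 + (slope x)\<^sup>2) powr (-5/2) = (width / l)\<^sup>2 * (sin (ang x) / k)"
    using k s by (simp add: slope'_def k_def[symmetric] power_divide power_mult_distrib field_simps power_numeral_reduce)
  also have "sin (ang x) / k = sin \<alpha> - slope x * cos \<alpha>"
  proof -
    have "sin (ang x) = sin (\<alpha> - (\<alpha> - ang x))" by simp
    also have "\<dots> = sin \<alpha> * k - sin (\<alpha> - ang x) * cos \<alpha>"
      unfolding sin_diff[of \<alpha> "\<alpha> - ang x"] by (simp add: k_def)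
    finally show ?thesis using k by (simp add: slope_def tan_def k_def[symmetric] field_simps)
  qed
  finally show ?thesis .
qed

end

context elastica_profile begin

section \<open>The even profile, its height and its energy\<close>

definition prof_v :: "real \<Rightarrow> real" where "prof_v x = (if 0 \<le> x then - slope x else slope (- x))"
definition prof_w :: "real \<Rightarrow> real" where "prof_w x = - slope' \<bar>x\<bar>"
text \<open>Integration from the right end builds in the boundary value at 1; the one at -1 follows
  because \<open>prof_v\<close> is odd.\<close>

definition prof_u :: "real \<Rightarrow> real" where "prof_u x = - integral {x..1} prof_v"

lemma prof_v_odd: "prof_v (- x) = - prof_v x"
  using slope_0 by (cases "x = 0") (auto simp: prof_v_def)

lemma prof_v_continuous: "continuous_on {-1..1} prof_v"
proof -
  have "continuous_on ({0..1} \<union> {-1..0}) (\<lambda>x. if 0 \<le> x then - slope x else slope (- x))"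
  proof (rule continuous_on_If)
    show "continuous_on {0..1} (\<lambda>x. - slope x)" by (intro continuous_intros slope_continuous)
    show "continuous_on {-1..0} (\<lambda>x. slope (- x))"
      by (rule continuous_on_compose2[OF slope_continuous]) (auto intro!: continuous_intros)
  qed (auto simp: slope_0)
  moreover have "{0..1} \<union> {-1..0} = {-1..1::real}" by auto
  ultimately show ?thesis by (simp add: prof_v_def[abs_def])
qed

lemma prof_w_continuous: "continuous_on {-1..1} prof_w"
  unfolding prof_w_def[abs_def]
  by (intro continuous_on_minus continuous_on_compose2[OF slope'_continuous]) (auto intro!: continuous_intros)

lemma prof_v_has_derivative:
  assumes "x \<noteq> 0" "x \<noteq> l" "x \<noteq> - l"
  shows "(prof_v has_real_derivative prof_w x) (at x)"
proof (cases "0 < x")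
  case True
  have "((\<lambda>x. - slope x) has_real_derivative - slope' x) (at x)"
    by (intro DERIV_minus slope_has_derivative True assms)
  then have "(prof_v has_real_derivative - slope' x) (at x)"
    by (rule has_field_derivative_transform_within_open[where S = "{0<..}"]) (use True in \<open>auto simp: prof_v_def\<close>)
  then show ?thesis using True by (simp add: prof_w_def)
next
  case False
  with assms have x: "x < 0" by simp
  have "((\<lambda>x. slope (- x)) has_real_derivative slope' (- x) * (- 1)) (at x)"
    by (rule DERIV_chain2[OF slope_has_derivative]) (use x assms in \<open>auto intro!: derivative_eq_intros\<close>)
  then have "(prof_v has_real_derivative slope' (- x) * (- 1)) (at x)"
    by (rule has_field_derivative_transform_within_open[where S = "{..<0}"]) (use x in \<open>auto simp: prof_v_def\<close>)
  then show ?thesis using x by (simp add: prof_w_def)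
qed

lemma prof_v_integral_split:
  assumes "-1 \<le> a" "a \<le> b" "b \<le> 1"
  shows "prof_u a = prof_u b - integral {a..b} prof_v"
proof -
  have "integral {a..b} prof_v + integral {b..1} prof_v = integral {a..1} prof_v"
    using assms by (intro Henstock_Kurzweil_Integration.integral_combine integrable_continuous_real
        continuous_on_subset[OF prof_v_continuous]) auto
  then show ?thesis by (simp add: prof_u_def)
qed

lemma prof_u_even:
  assumes "x \<in> {-1..1}"
  shows "prof_u (- x) = prof_u x"
proof -
  have *: "prof_u (- y) = prof_u y" if "y \<in> {0..1}" for y
  proof -
    have "integral {-y..y} (\<lambda>x. prof_v (- x)) = integral {-y..y} prof_v"
      using Henstock_Kurzweil_Integration.integral_reflect_real[of y "-y" prof_v] by simp
    then have "integral {-y..y} prof_v = 0"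
      by (simp add: prof_v_odd)
    then show ?thesis using prof_v_integral_split[of "-y" y] that by simp
  qed
  show ?thesis
  proof (cases "0 \<le> x")
    case True then show ?thesis using *[of x] assms by simp
  next
    case False then show ?thesis using *[of "-x"] assms by simp
  qed
qed

lemma prof_u_1: "prof_u 1 = 0"
  by (simp add: prof_u_def)

lemma prof_u_minus_1: "prof_u (-1) = 0"
  using prof_u_even[of 1] prof_u_1 by simp

lemma prof_rep: "W22_rep prof_u prof_v prof_w"
  unfolding W22_rep_def
proof (intro conjI ballI)
  show "prof_w absolutely_integrable_on {-1..1}"
    by (intro absolutely_integrable_continuous_real prof_w_continuous)
  show "(\<lambda>x. (prof_w x)\<^sup>2) integrable_on {-1..1}"
    by (intro integrable_continuous_real continuous_intros prof_w_continuous)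
  fix x :: real assume x: "x \<in> {-1..1}"
  have "(prof_w has_integral prof_v x - prof_v (-1)) {-1..x}"
  \<comment> \<open>The derivative of \<open>prof_v\<close> is known except at the centre and the
    two junctions, and finitely many exceptions are allowed.\<close>
  proof (rule fundamental_theorem_of_calculus_interior_strong[of "{0, l, - l}"])
    show "continuous_on {-1..x} prof_v"
      by (rule continuous_on_subset[OF prof_v_continuous]) (use x in auto)
    fix t assume "t \<in> {-1<..<x} - {0, l, - l}"
    then show "(prof_v has_vector_derivative prof_w t) (at t)"
      using prof_v_has_derivative[of t] by (simp add: has_real_derivative_iff_has_vector_derivative)
  qed (use x in auto)
  then show "prof_v x = prof_v (-1) + integral {-1..x} prof_w"
    by (simp add: integral_unique)
  show "prof_u x = prof_u (-1) + integral {-1..x} prof_v"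
    using prof_v_integral_split[of "-1" x] x by simp
qed

lemma prof_u_eq:
  assumes "0 \<le> x" "x \<le> 1"
  shows "prof_u x = integral {x..1} slope"
proof -
  have "integral {x..1} prof_v = integral {x..1} (\<lambda>t. - slope t)"
    by (rule Henstock_Kurzweil_Integration.integral_cong) (use assms in \<open>auto simp: prof_v_def\<close>)
  then show ?thesis by (simp add: prof_u_def)
qed

lemma slope_integrable: "0 \<le> a \<Longrightarrow> b \<le> 1 \<Longrightarrow> slope integrable_on {a..b}"
  by (intro integrable_continuous_real continuous_on_subset[OF slope_continuous]) auto

text \<open>The profile is concave on \<open>{0..1}\<close>, as its descent \<open>slope\<close>
  increases. Concretely, the mean of \<open>slope\<close> over \<open>{0..x}\<close> is at most
  \<open>slope x\<close>, and its mean over \<open>{x..1}\<close> is at least that.\<close>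

lemma prof_u_ge_chord:
  assumes "x \<in> {-1..1}"
  shows "(1 - \<bar>x\<bar>) * prof_u 0 \<le> prof_u x"
proof -
  have *: "(1 - x) * prof_u 0 \<le> prof_u x" if x: "0 \<le> x" "x \<le> 1" for x
  proof -
    have A: "integral {0..x} slope \<le> x * slope x"
    proof -
      have "integral {0..x} slope \<le> integral {0..x} (\<lambda>_. slope x)"
        using x by (intro integral_le slope_integrable slope_mono) auto
      then show ?thesis using x by simp
    qed
    have B: "(1 - x) * slope x \<le> integral {x..1} slope"
    proof -
      have "integral {x..1} (\<lambda>_. slope x) \<le> integral {x..1} slope"
        using x by (intro integral_le slope_integrable slope_mono) auto
      then show ?thesis using x by simp
    qed
    have "(1 - x) * integral {0..x} slope \<le> (1 - x) * (x * slope x)"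
      using A x by (intro mult_left_mono) auto
    also have "\<dots> = x * ((1 - x) * slope x)" by simp
    also have "\<dots> \<le> x * integral {x..1} slope"
      using B x by (intro mult_left_mono) auto
    finally have "(1 - x) * (integral {0..x} slope + integral {x..1} slope) \<le> integral {x..1} slope"
      by (simp add: algebra_simps)
    also have "integral {0..x} slope + integral {x..1} slope = integral {0..1} slope"
      using x by (intro Henstock_Kurzweil_Integration.integral_combine slope_integrable) auto
    finally show ?thesis using x by (simp add: prof_u_eq)
  qed
  show ?thesis
  proof (cases "0 \<le> x")
    case True then show ?thesis using *[of x] assms by simp
  next
    case False then show ?thesis using *[of "-x"] assms prof_u_even[of x] by simp
  qed
qed

text \<open>The descent along the straight piece alone; for fixed l < 1 it makes the height
  arbitrarily large as \<alpha> tends to pi/2.\<close>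

lemma prof_u_0_ge: "(1 - l) * tan \<alpha> \<le> prof_u 0"
proof -
  have "integral {l..1} slope = integral {l..1} (\<lambda>_. tan \<alpha>)"
    by (rule Henstock_Kurzweil_Integration.integral_cong) (simp add: slope_ge)
  then have "integral {l..1} slope = (1 - l) * tan \<alpha>" using l by simp
  moreover have "integral {l..1} slope \<le> integral {0..1} slope"
    using l by (intro integral_subset_le slope_integrable) (auto intro: slope_nonneg)
  ultimately show ?thesis by (simp add: prof_u_eq)
qed

lemma prof_u_0_eq:
  assumes "l = 1"
  shows "prof_u 0 = height / width"
proof -
  \<comment> \<open>The ordinate belonging to \<open>abscissa\<close>: the normalized vertical
    distance from the inflection point, as a function of the angle.\<close>
  let ?U = "\<lambda>x. (2 * sin \<alpha> * sqrt (sin (ang x)) - cos \<alpha> * sqsin (ang x)) / width"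
  have "((\<lambda>x. - slope x) has_integral ?U 1 - ?U 0) {0..1}"
  proof (rule fundamental_theorem_of_calculus_interior)
    have "continuous_on {0..1} (\<lambda>x. sqsin (ang x))"
      by (rule continuous_on_compose2[OF sqsin_continuous ang_continuous]) (auto simp: ang_range)
    then show "continuous_on {0..1} ?U"
      using width_pos by (intro continuous_intros ang_continuous) auto
    fix x :: real assume x: "x \<in> {0<..<1}"
    define t where "t = ang x"
    have "ang x = angle (1 - x)" unfolding ang_def using x by (simp add: assms)
    then have t: "0 < t" "t \<le> \<alpha>"
      using x angle_pos[of "1 - x"] ang_range[of x] by (simp_all add: t_def)
    have s: "sin t > 0" using t \<alpha> by (intro sin_gt_zero) auto
    have c: "cos (\<alpha> - t) > 0" using t by (intro cos_diff_pos) auto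
    let ?d = "(2 * sin \<alpha> * (cos t / (2 * sqrt (sin t))) - cos \<alpha> * sqrt (sin t)) / width"
    have "((\<lambda>t. sqrt (sin t)) has_real_derivative cos t / (2 * sqrt (sin t))) (at t)"
      using s by (auto intro!: derivative_eq_intros simp: field_simps)
    then have "((\<lambda>t. (2 * sin \<alpha> * sqrt (sin t) - cos \<alpha> * sqsin t) / width) has_real_derivative ?d) (at t)"
      using t by (intro DERIV_cdivide DERIV_diff DERIV_cmult sqsin_has_derivative) auto
    moreover have "(ang has_real_derivative - (width * sqrt (sin t) / cos (\<alpha> - t))) (at x)"
      using ang_has_derivative[of x] x assms by (simp add: t_def)
    ultimately have "(?U has_real_derivative ?d * (- (width * sqrt (sin t) / cos (\<alpha> - t)))) (at x)"
      unfolding t_def by (rule DERIV_chain2)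
    moreover have "?d * (- (width * sqrt (sin t) / cos (\<alpha> - t))) = - slope x"
    proof -
      have *: "(2 * a * (b / (2 * r)) - e * r) / w * (- (w * r / k)) = - ((a * b - e * (r * r)) / k)"
        if "r > 0" "w > 0" "k > 0" for a b e r w k :: real
        using that by (simp add: field_simps)
      have "sqrt (sin t) > 0" using s by simp
      from *[OF this width_pos c, of "sin \<alpha>" "cos t" "cos \<alpha>"] show ?thesis
        using s by (simp add: slope_def tan_def sin_diff t_def)
    qed
    ultimately show "(?U has_vector_derivative - slope x) (at x)"
      by (simp add: has_real_derivative_iff_has_vector_derivative)
  qed simp
  then have "integral {0..1} (\<lambda>x. - slope x) = ?U 1 - ?U 0" by (rule integral_unique)
  moreover have "ang 1 = 0" using assms by (intro ang_ge) simp
  ultimately show ?thesis by (simp add: prof_u_eq ang_0 height_def)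
qed

lemma prof_half_energy: "curvature_energy {0..1} prof_v prof_w = (width / l)\<^sup>2 * (sin \<alpha> - prof_u 0 * cos \<alpha>)"
proof -
  have "curvature_energy {0..1} prof_v prof_w = integral {0..1} (\<lambda>x. (width / l)\<^sup>2 * (sin \<alpha> - slope x * cos \<alpha>))"
    unfolding curvature_energy_def
    by (rule Henstock_Kurzweil_Integration.integral_cong)
      (simp add: slope_energy_density[symmetric] prof_v_def prof_w_def)
  also have "\<dots> = (width / l)\<^sup>2 * (sin \<alpha> - prof_u 0 * cos \<alpha>)"
  proof (rule integral_unique)
    have "((\<lambda>x. (width / l)\<^sup>2 * (sin \<alpha> - slope x * cos \<alpha>)) has_integral (width / l)\<^sup>2 * ((1 - 0) * sin \<alpha> - integral {0..1} slope * cos \<alpha>)) {0..1}"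
      using has_integral_const_real[of "sin \<alpha>" 0 1]
      by (intro has_integral_mult_right has_integral_diff has_integral_mult_left integrable_integral slope_integrable) auto
    then show "((\<lambda>x. (width / l)\<^sup>2 * (sin \<alpha> - slope x * cos \<alpha>)) has_integral (width / l)\<^sup>2 * (sin \<alpha> - prof_u 0 * cos \<alpha>)) {0..1}"
      by (simp add: prof_u_eq)
  qed
  finally show ?thesis .
qed

lemma prof_energy: "Bfun prof_u = 2 * ((width / l)\<^sup>2 * (sin \<alpha> - prof_u 0 * cos \<alpha>))"
proof -
  have "(\<lambda>x. - prof_v (- x)) = prof_v" "(\<lambda>x. prof_w (- x)) = prof_w"
    by (auto simp: prof_v_odd prof_w_def)
  then have "Bfun prof_u = curvature_energy {0..1} prof_v prof_w + curvature_energy {0..1} prof_v prof_w"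
    using Bfun_split[OF prof_rep, of 0] by simp
  then show ?thesis by (simp add: prof_half_energy)
qed

end

section \<open>Minimizers\<close>

lemma Bfun_nonneg: "u \<in> X_psi \<psi> \<Longrightarrow> 0 \<le> Bfun u"
proof -
  assume "u \<in> X_psi \<psi>"
  then obtain v w where r: "W22_rep u v w" using W22_iff by (auto simp: X_psi_def)
  have "0 \<le> curvature_energy {-1..1} v w"
    unfolding curvature_energy_def by (rule integral_nonneg[OF curvature_integrable[OF r]]) auto
  then show ?thesis by (simp add: Bfun_eq[OF r])
qed

lemma X_psi_symD:
  assumes "u \<in> X_psi_sym \<psi>"
  shows "\<exists>v w. W22_rep u v w" "u (-1) = 0" "u 1 = 0" "\<psi> 0 \<le> u 0" "x \<in> {-1..1} \<Longrightarrow> u x = u (- x)"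
proof -
  have u: "u \<in> X_psi \<psi>" and even: "\<forall>x\<in>{-1..1}. u x = u (- x)"
    using assms unfolding X_psi_sym_def by blast+
  from u show "\<exists>v w. W22_rep u v w" "u (-1) = 0" "u 1 = 0" "\<psi> 0 \<le> u 0"
    by (auto simp: X_psi_def W22_iff)
  from even show "x \<in> {-1..1} \<Longrightarrow> u x = u (- x)" by blast
qed

text \<open>By continuity the cone is affine on the closed half interval, and its end value is
  negative. With \<open>prof_u_ge_chord\<close>, admissibility of a profile reduces to its height at
  0.\<close>

lemma symmetric_cone_le_chord:
  fixes \<psi> :: "real \<Rightarrow> real"
  assumes cont: "continuous_on {-1..1} \<psi>"
    and even: "\<forall>x\<in>{-1..1}. \<psi> x = \<psi> (- x)"
    and affine: "\<exists>a b. \<forall>x\<in>{0<..<1}. \<psi> x = a * x + b"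
    and neg: "\<psi> 1 < 0" and x: "x \<in> {-1..1}"
  shows "\<psi> x \<le> (1 - \<bar>x\<bar>) * \<psi> 0"
proof -
  obtain a b where ab: "\<And>x. x \<in> {0<..<1} \<Longrightarrow> \<psi> x = a * x + b" using affine by blast
  have cl: "\<psi> x - (a * x + b) = 0" if "x \<in> {0..1}" for x
  proof (rule continuous_constant_on_closure[where S = "{0<..<1}" and f = "\<lambda>x. \<psi> x - (a * x + b)"])
    show "continuous_on (closure {0<..<1}) (\<lambda>x. \<psi> x - (a * x + b))"
      by (auto intro!: continuous_intros continuous_on_subset[OF cont])
  qed (use that ab in auto)
  have b: "\<psi> 0 = b" and ab1: "\<psi> 1 = a + b" using cl[of 0] cl[of 1] by auto
  have *: "\<psi> y \<le> (1 - y) * \<psi> 0" if "y \<in> {0..1}" for y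
  proof -
    have "y * (a + b) \<le> 0" using that neg ab1 by (intro mult_nonneg_nonpos) auto
    then show ?thesis using cl[OF that] b by (simp add: algebra_simps)
  qed
  show ?thesis
  proof (cases "0 \<le> x")
    case True then show ?thesis using *[of x] x by simp
  next
    case False
    moreover have "\<psi> x = \<psi> (- x)" using even x by blast
    ultimately show ?thesis using *[of "- x"] x by simp
  qed
qed

lemma (in elastica_profile) prof_u_admissible:
  assumes "\<And>x. x \<in> {-1..1} \<Longrightarrow> \<psi> x \<le> (1 - \<bar>x\<bar>) * \<psi> 0" "\<psi> 0 \<le> prof_u 0"
  shows "prof_u \<in> X_psi_sym \<psi>"
proof -
  have "\<psi> x \<le> prof_u x" if x: "x \<in> {-1..1}" for x
  proof -
    have "(1 - \<bar>x\<bar>) * \<psi> 0 \<le> (1 - \<bar>x\<bar>) * prof_u 0" using x assms(2) by (intro mult_left_mono) auto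
    with assms(1)[OF x] prof_u_ge_chord[OF x] show ?thesis by linarith
  qed
  moreover have "W22 prof_u" using prof_rep W22_iff by blast
  ultimately show ?thesis
    using prof_u_even prof_u_1 prof_u_minus_1 by (auto simp: X_psi_sym_def X_psi_def)
qed

section \<open>Non-existence for high obstacles\<close>

text \<open>The straight piece gives sin \<alpha> - u(0) cos \<alpha> \<le> l sin \<alpha> \<le> l,
  so the energy is at most 2 width^2 / l. As \<alpha> tends to pi/2 the width tends to
  \<open>c_star\<close> while the height grows beyond any bound.\<close>

lemma profile_energy_approx:
  assumes B: "2 * c_star\<^sup>2 < B"
  obtains \<alpha> l where "elastica_profile \<alpha> l" "h \<le> elastica_profile.prof_u \<alpha> l 0" "Bfun (elastica_profile.prof_u \<alpha> l) < B"
proof -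
  \<comment> \<open>The width as a function of \<alpha>, before an angle has been fixed for the
    locale.\<close>
  define d where "d \<alpha> = 2 * cos \<alpha> * sqrt (sin \<alpha>) + sin \<alpha> * sqsin \<alpha>" for \<alpha>
  have c1: "c_star \<ge> 1" by (rule c_star_ge_1)
  have Bpos: "B > 0" using B zero_le_power2[of c_star] by linarith
  have cB: "0 < 2 * c_star\<^sup>2 / B" "2 * c_star\<^sup>2 / B < 1"
    using B Bpos c1 by simp_all
  \<comment> \<open>The length \<open>l\<close> is fixed first, below 1 but so close to it that the
    limiting energy \<open>2 * (c_star\<^sup>2 / l)\<close> is still below \<open>B\<close>.\<close>
  then obtain l where l: "2 * c_star\<^sup>2 / B < l" "l < 1" using dense by blast
  have l0: "0 < l" using l cB by linarith
  have lB: "2 * (c_star\<^sup>2 / l) < B" using l l0 Bpos by (simp add: field_simps)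
  have "isCont d (pi/2)"
    unfolding d_def[abs_def] by (intro continuous_intros DERIV_isCont[OF sqsin_has_derivative]) (use pi_gt_zero in linarith)
  then have "(d \<longlongrightarrow> d (pi/2)) (at_left (pi/2))"
    by (simp add: isCont_def filterlim_at_split)
  moreover have "d (pi/2) = c_star" by (simp add: d_def sqsin_half_pi)
  ultimately have "(d \<longlongrightarrow> c_star) (at_left (pi/2))" by simp
  then have "((\<lambda>\<alpha>. 2 * ((d \<alpha>)\<^sup>2 / l)) \<longlongrightarrow> 2 * (c_star\<^sup>2 / l)) (at_left (pi/2))"
    using l0 by (intro tendsto_intros) auto
  then have e1: "\<forall>\<^sub>F \<alpha> in at_left (pi/2). 2 * ((d \<alpha>)\<^sup>2 / l) < B"
    by (rule order_tendstoD) (rule lB)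
  have e2: "\<forall>\<^sub>F \<alpha> in at_left (pi/2). h / (1 - l) \<le> tan \<alpha>"
    using filterlim_tan_at_left by (simp add: filterlim_at_top)
  have e3: "\<forall>\<^sub>F \<alpha> in at_left (pi/2). \<alpha> \<in> {0<..<pi/2}"
    by (rule eventually_at_left_real) simp
  obtain \<alpha> where al: "2 * ((d \<alpha>)\<^sup>2 / l) < B" "h / (1 - l) \<le> tan \<alpha>" "0 < \<alpha>" "\<alpha> < pi/2"
    using eventually_happens[OF eventually_conj[OF e1 eventually_conj[OF e2 e3]]] by auto
  note l' = l
  interpret elastica_profile \<alpha> l
    using al l l0 by unfold_locales auto
  have tl: "(1 - l) * tan \<alpha> \<ge> h" using al l' by (simp add: field_simps)
  have "prof_u 0 * cos \<alpha> \<ge> (1 - l) * tan \<alpha> * cos \<alpha>"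
    using prof_u_0_ge sc_pos by (intro mult_right_mono) auto
  moreover have "tan \<alpha> * cos \<alpha> = sin \<alpha>" using sc_pos by (simp add: tan_def)
  ultimately have "prof_u 0 * cos \<alpha> \<ge> (1 - l) * sin \<alpha>" by (simp add: mult.assoc)
  then have "sin \<alpha> - prof_u 0 * cos \<alpha> \<le> l * sin \<alpha>" by (simp add: algebra_simps)
  also have "\<dots> \<le> l * 1" using l0 by (intro mult_left_mono) auto
  finally have "(width / l)\<^sup>2 * (sin \<alpha> - prof_u 0 * cos \<alpha>) \<le> (width / l)\<^sup>2 * (l * 1)"
    by (intro mult_left_mono) auto
  also have "\<dots> = (d \<alpha>)\<^sup>2 / l" using l0 by (simp add: width_def d_def power2_eq_square)
  finally have "Bfun prof_u < B" using al(1) by (simp add: prof_energy)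
  moreover have "h \<le> prof_u 0" using tl prof_u_0_ge by linarith
  ultimately show ?thesis using that elastica_profile_axioms by blast
qed

text \<open>A minimizer would have energy strictly above \<open>2 * c_star\<^sup>2\<close>, and some
  admissible profile undercuts it. The profile is symmetric, so the argument serves every class
  between the symmetric one and the full one.\<close>

lemma no_minimizer_if_high_obstacle:
  assumes chord: "\<And>x. x \<in> {-1..1} \<Longrightarrow> \<psi> x \<le> (1 - \<bar>x\<bar>) * \<psi> 0" and h: "\<psi> 0 \<ge> h_star"
    and Y: "X_psi_sym \<psi> \<subseteq> Y" "Y \<subseteq> X_psi \<psi>"
  shows "\<not> is_minimizer Y u"
proof
  assume m: "is_minimizer Y u"
  then have "Bfun u > 2 * c_star\<^sup>2"
    using Bfun_gt_if_high_obstacle[of u \<psi>] h Y by (auto simp: is_minimizer_def)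
  then obtain \<alpha> l where al: "elastica_profile \<alpha> l" "\<psi> 0 \<le> elastica_profile.prof_u \<alpha> l 0"
     "Bfun (elastica_profile.prof_u \<alpha> l) < Bfun u"
    by (rule profile_energy_approx)
  have "elastica_profile.prof_u \<alpha> l \<in> Y"
    using elastica_profile.prof_u_admissible[OF al(1) chord al(2)] Y by blast
  moreover have "bdd_below (Bfun ` Y)"
    using Bfun_nonneg Y by (intro bdd_belowI2[where m = 0]) blast
  ultimately have "(INF v\<in>Y. Bfun v) \<le> Bfun (elastica_profile.prof_u \<alpha> l)"
    by (rule cINF_lower[rotated])
  with al(3) m show False by (simp add: is_minimizer_def)
qed

section \<open>Existence and uniqueness for low obstacles\<close>

text \<open>Intermediate values of height - h width: at \<open>arctan h\<close> this is negative,
  since the terms with \<open>sqrt (sin a)\<close> cancel there; at pi/2 it is 2 - h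
  \<open>c_star\<close>, positive exactly when h < \<open>h_star\<close>.\<close>

lemma elastica_of_height:
  assumes h: "0 < h" "h < h_star"
  obtains \<alpha> where "elastica \<alpha>" "elastica.height \<alpha> = h * elastica.width \<alpha>"
proof -
  define f where "f \<alpha> = 2 * sin \<alpha> * sqrt (sin \<alpha>) - cos \<alpha> * sqsin \<alpha>
     - h * (2 * cos \<alpha> * sqrt (sin \<alpha>) + sin \<alpha> * sqsin \<alpha>)" for \<alpha>
  define a where "a = arctan h"
  have a: "0 < a" "a < pi/2" using h arctan_ubound by (auto simp: a_def)
  have sc: "sin a > 0" "cos a > 0" using sin_cos_pos[OF a] by auto
  have sa: "sin a = h * cos a" using sc tan_arctan[of h] by (simp add: a_def[symmetric] tan_def field_simps)
  have Y: "sqsin a > 0" using a by (intro sqsin_pos) auto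
  have "f a = 2 * sqrt (sin a) * (sin a - h * cos a) - sqsin a * (cos a + h * sin a)"
    by (simp add: f_def algebra_simps)
  also have "\<dots> = - (sqsin a * (cos a + h * sin a))" by (simp only: sa) simp
  also have "\<dots> < 0" using Y sc h by (simp add: add_pos_pos)
  finally have fa: "f a < 0" .
  have fb: "f (pi/2) > 0"
    using h c_star_ge_1 by (simp add: f_def sqsin_half_pi h_star_def field_simps)
  have "continuous_on {a..pi/2} f"
    unfolding f_def[abs_def] using a
    by (intro continuous_intros continuous_on_subset[OF sqsin_continuous]) auto
  then obtain \<alpha> where al: "a \<le> \<alpha>" "\<alpha> \<le> pi/2" "f \<alpha> = 0"
    using IVT'[of f a 0 "pi/2"] fa fb a by auto
  with fb have "\<alpha> \<noteq> pi/2" by (metis less_irrefl)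
  with al a interpret elastica \<alpha> by unfold_locales auto
  have "height = h * width" using al(3) by (simp add: f_def height_def width_def)
  then show ?thesis using that elastica_axioms by blast
qed

lemma unique_minimizer_if_low_obstacle:
  assumes chord: "\<And>x. x \<in> {-1..1} \<Longrightarrow> \<psi> x \<le> (1 - \<bar>x\<bar>) * \<psi> 0" and h: "0 < \<psi> 0" "\<psi> 0 < h_star"
  obtains u where "is_minimizer (X_psi_sym \<psi>) u"
    "\<And>u' x. is_minimizer (X_psi_sym \<psi>) u' \<Longrightarrow> x \<in> {-1..1} \<Longrightarrow> u' x = u x"
proof -
  let ?h = "\<psi> 0" and ?X = "X_psi_sym \<psi>"
  obtain \<alpha> where el: "elastica \<alpha>" and hw: "elastica.height \<alpha> = ?h * elastica.width \<alpha>"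
    using elastica_of_height[OF h] by blast
  interpret elastica_profile \<alpha> 1
    using el by (simp add: elastica_profile_def elastica_profile_axioms_def)
  have u0: "prof_u 0 = ?h" using prof_u_0_eq hw width_pos by simp
  have h2: "?h \<le> 2"
  proof -
    have "h_star \<le> 2" using c_star_ge_1 by (simp add: h_star_def field_simps)
    with h show ?thesis by linarith
  qed
  \<comment> \<open>The scaling constant of the elastica is the multiplier for which \<alpha> is the
    minimum of the dual energy.\<close>
  have mu: "width = 2 * sqrt (sin \<alpha>) / (cos \<alpha> + ?h * sin \<alpha>)"
  proof -
    have "(2 * c * r + s * y) * c + (2 * s * r - c * y) * s = 2 * r * (s\<^sup>2 + c\<^sup>2)" for c r s y :: real
      by algebra
    from this[of "cos \<alpha>" "sqrt (sin \<alpha>)" "sin \<alpha>" "sqsin \<alpha>"]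
    have "width * cos \<alpha> + height * sin \<alpha> = 2 * sqrt (sin \<alpha>)"
      unfolding width_def[symmetric] height_def[symmetric] by simp
    then have "width * (cos \<alpha> + ?h * sin \<alpha>) = 2 * sqrt (sin \<alpha>)"
      using hw by (simp add: algebra_simps)
    moreover have "cos \<alpha> + ?h * sin \<alpha> > 0" using sc_pos h by (intro add_pos_pos) auto
    ultimately show ?thesis by (simp add: eq_divide_eq)
  qed
  define E where "E = dual_energy width 1 ?h \<alpha>"
  \<comment> \<open>Both sides equal \<open>width * sqsin \<alpha>\<close>: the calibration is sharp
    on the elastica.\<close>
  have half: "curvature_energy {0..1} prof_v prof_w = E"
  proof -
    have "width * (sin \<alpha> - ?h * cos \<alpha>) = sqsin \<alpha>"
      using width_height hw by (simp add: algebra_simps)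
    then have "width\<^sup>2 * (sin \<alpha> - ?h * cos \<alpha>) = width * sqsin \<alpha>"
      by (simp add: power2_eq_square)
    then show ?thesis by (simp add: E_def dual_energy_def prof_half_energy u0)
  qed
  have BU: "Bfun prof_u = 2 * E" using half by (simp add: prof_energy prof_half_energy)
  have low: "E \<le> curvature_energy {0..1} v w \<and> E \<le> curvature_energy {0..1} (\<lambda>x. - v (- x)) (\<lambda>x. w (- x))
     \<and> Bfun u = curvature_energy {0..1} v w + curvature_energy {0..1} (\<lambda>x. - v (- x)) (\<lambda>x. w (- x)) \<and> v 0 = 0"
    if u: "u \<in> ?X" and r: "W22_rep u v w" for u v w
  proof -
    have v0: "v 0 = 0" by (rule even_imp_derivative_0[OF r]) (rule X_psi_symD(5)[OF u])
    have b: "u 1 = 0" "u (-1) = 0" "?h \<le> u 0" using X_psi_symD(2-4)[OF u] by simp_all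
    have "E \<le> curvature_energy {0..1} v w"
      unfolding E_def by (rule half_energy_lower_bound(1)[OF r _ _ _ h(1) h2 \<alpha> mu]) (use v0 b in auto)
    moreover have "E \<le> curvature_energy {0..1} (\<lambda>x. - v (- x)) (\<lambda>x. w (- x))"
      unfolding E_def by (rule half_energy_lower_bound(1)[OF W22_rep_reflect[OF r] _ _ _ h(1) h2 \<alpha> mu]) (use v0 b in auto)
    ultimately show ?thesis using Bfun_split[OF r, of 0] v0 by simp
  qed
  have UX: "prof_u \<in> ?X" by (rule prof_u_admissible[OF chord]) (use u0 in auto)
  have lower: "2 * E \<le> Bfun u" if "u \<in> ?X" for u
  proof -
    obtain v w where "W22_rep u v w" using X_psi_symD(1)[OF \<open>u \<in> ?X\<close>] by blast
    from low[OF that this] show ?thesis by linarith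
  qed
  have inf: "(INF v\<in>?X. Bfun v) = 2 * E"
  proof (rule antisym)
    have "bdd_below (Bfun ` ?X)" using lower by (intro bdd_belowI2[where m = "2 * E"])
    from cINF_lower[OF this UX] show "(INF v\<in>?X. Bfun v) \<le> 2 * E" by (simp add: BU)
    show "2 * E \<le> (INF v\<in>?X. Bfun v)" using UX lower by (intro cINF_greatest) auto
  qed
  have U: "is_minimizer ?X prof_u" using UX BU inf by (simp add: is_minimizer_def)
  have ode: "((\<lambda>x. elastic_primitive (- v x)) has_real_derivative width * sqrt (sin \<alpha> - (- v x) * cos \<alpha>)) (at x within {0..1})"
    if m: "is_minimizer ?X u" and r: "W22_rep u v w" and x: "x \<in> {0..1}" for u v w x
  proof -
    have u: "u \<in> ?X" and B: "Bfun u = 2 * E" using m inf by (auto simp: is_minimizer_def)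
    note l = low[OF u r]
    \<comment> \<open>Each half costs at least \<open>E\<close> and together they cost
      \<open>2 * E\<close>, so the right half costs exactly \<open>E\<close>.\<close>
    then have eq: "curvature_energy {0..1} v w = dual_energy width 1 ?h \<alpha>" using B E_def by linarith
    show ?thesis
      by (rule half_energy_lower_bound(2)[OF r _ _ _ h(1) h2 \<alpha> mu eq x])
        (use l X_psi_symD(3,4)[OF u] in auto)
  qed
  have unique: "u x = prof_u x" if m: "is_minimizer ?X u" and x: "x \<in> {-1..1}" for u x
  proof -
    have u: "u \<in> ?X" using m by (simp add: is_minimizer_def)
    then obtain v w where r: "W22_rep u v w" using X_psi_symD(1) by blast
    have v0: "v 0 = 0" using low[OF u r] by blast
    \<comment> \<open>Both slopes solve the same first order equation and start from 0.\<close>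
    have eq: "- v x = - prof_v x" if "x \<in> {0..1}" for x
      by (rule calibrated_unique[OF ode[OF m r] ode[OF U prof_rep] _ _ _ that])
        (use v0 slope_0 width_pos sc_pos in \<open>auto simp: prof_v_def\<close>)
    have right: "u x = prof_u x" if x: "x \<in> {0..1}" for x
    proof -
      have vi: "v integrable_on {-1..1}" by (intro integrable_continuous_real W22_rep_facts(3)[OF r])
      have "integral {-1..x} v + integral {x..1} v = integral {-1..1} v"
        using x by (intro Henstock_Kurzweil_Integration.integral_combine vi) auto
      moreover have R: "u y = u (-1) + integral {-1..y} v" if "y \<in> {-1..1}" for y
        using r that unfolding W22_rep_def by blast
      note R[of x] R[of 1]
      moreover have "integral {x..1} v = integral {x..1} prof_v"
        by (rule Henstock_Kurzweil_Integration.integral_cong) (use eq x in auto)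
      moreover have "u 1 = 0" using X_psi_symD(3)[OF u] .
      ultimately show ?thesis using x by (simp add: prof_u_def)
    qed
    show ?thesis
    proof (cases "0 \<le> x")
      case True then show ?thesis using right x by simp
    next
      case False
      moreover have "u x = u (- x)" by (rule X_psi_symD(5)[OF u x])
      ultimately show ?thesis using right[of "- x"] prof_u_even[OF x] x by simp
    qed
  qed
  show ?thesis by (rule that[of prof_u]) (rule U, rule unique)
qed

theorem theorem3p1:
  fixes \<psi> :: "real \<Rightarrow> real"
  assumes "continuous_on {-1..1} \<psi>"
    and "\<forall>x\<in>{-1..1}. \<psi> x = \<psi> (-x)"
    and "\<exists>a b. \<forall>x\<in>{0<..<1}. \<psi> x = a * x + b"
    and "\<psi> (-1) < 0" and "\<psi> 1 < 0"
    and "\<psi> 0 > 0"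
  shows "(\<psi> 0 < h_star \<longrightarrow>
            (\<exists>u. is_minimizer (X_psi_sym \<psi>) u \<and>
               (\<forall>v. is_minimizer (X_psi_sym \<psi>) v \<longrightarrow> (\<forall>x\<in>{-1..1}. v x = u x))))
       \<and> (\<psi> 0 \<ge> h_star \<longrightarrow>
            (\<nexists>u. is_minimizer (X_psi_sym \<psi>) u) \<and> (\<nexists>u. is_minimizer (X_psi \<psi>) u))"
proof (intro conjI impI)
  note chord = symmetric_cone_le_chord[OF assms(1,2,3,5)]
  show "\<exists>u. is_minimizer (X_psi_sym \<psi>) u \<and>
      (\<forall>v. is_minimizer (X_psi_sym \<psi>) v \<longrightarrow> (\<forall>x\<in>{-1..1}. v x = u x))" if "\<psi> 0 < h_star"
    using unique_minimizer_if_low_obstacle[OF chord assms(6) that] by metis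
  have sub: "X_psi_sym \<psi> \<subseteq> X_psi \<psi>" by (auto simp: X_psi_sym_def)
  show "\<nexists>u. is_minimizer (X_psi_sym \<psi>) u" "\<nexists>u. is_minimizer (X_psi \<psi>) u" if "\<psi> 0 \<ge> h_star"
    using no_minimizer_if_high_obstacle[OF chord that _ _] sub by blast+
qed

end
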